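(* Let $\alpha$ be a non-degenerate, uniformly elliptic probability distribution on $(0,1)$ that is $s$-transient with $s\in(2,\infty)$. Then, under the annealed measure $P_0^\mu$, $$\frac{Z_n-v_\mu n}{\sigma_s\sqrt n}\ \to^{L^p}\ \Phi\qquad\forall\,p<s$$ as $n\to\infty$, where $\Phi$ is a standard normal random variable.
   Context: Let $\alpha$ be a probability distribution on $(0,1)$, with expectation denoted $\langle\cdot\rangle$; non-degenerate means not a point mass, uniformly elliptic means $\alpha([\mathfrak{c},1-\mathfrak{c}])=1$ for some $\mathfrak{c}>0$. Let $\mu=\alpha^{\mathbb{Z}}$ (i.i.d. environments $\omega=(\omega(x))_{x\in\mathbb{Z}}$), $\rho=(1-\omega(0))/\omega(0)$. $\alpha$ is $s$-transient if $\langle\log\rho\rangle<0$, $\langle\rho^s\rangle=1$ and $\langle\rho(\log\rho)_+\rangle<\infty$. RWRE: given $\omega$, $Z=(Z_n)_{n\ge0}$ is the Markov chain on $\mathbb{Z}$ with $Z_0=0$ which jumps from $x$ to $x+1$ with probability $\omega(x)$ and to $x-1$ with probability $1-\omega(x)$ (quenched law $P_0^\omega$); its annealed law is $P_0^\mu(\cdot)=\int P_0^\omega(\cdot)\,\mu(\mathrm{d}\omega)$. For $s$-transient $\alpha$ with $s\in(2,\infty)$, put $v_\mu=\frac{1-\langle\rho\rangle}{1+\langle\rho\rangle}>0$, and let $\sigma_s\in(0,\infty)$ be the constant (whose existence is a known theorem of Kesten, Kozlov and Spitzer) such that $(Z_n-v_\mu n)/(\sigma_s\sqrt n)$ converges in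 distribution under $P_0^\mu$ to a standard normal. Here $p>0$. Convergence $W_n\to^{L^p}W$ toward a random variable $W$ of which only the law is specified means: $W_n\to W$ in distribution and $E|W_n|^p\to E|W|^p<\infty$. *)

theory Defs
  imports "HOL-Probability.Probability"
begin

section \<open>The environment\<close>

definition env_distribution :: "real measure \<Rightarrow> bool" where
  "env_distribution \<alpha> \<longleftrightarrow> prob_space \<alpha> \<and> sets \<alpha> = sets borel \<and> measure \<alpha> {0<..<1} = 1"

definition non_degenerate :: "real measure \<Rightarrow> bool" where
  "non_degenerate \<alpha> \<longleftrightarrow> (\<forall>x. \<alpha> \<noteq> return borel x)"

definition uniformly_elliptic :: "real measure \<Rightarrow> bool" where
  "uniformly_elliptic \<alpha> \<longleftrightarrow> (\<exists>c>0. measure \<alpha> {c..1 - c} = 1)"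

definition rho :: "real \<Rightarrow> real" where
  "rho w = (1 - w) / w"

text \<open>Under \<open>\<mu> = \<alpha>\<^sup>\<int>\<close> the variable \<open>\<omega>(0)\<close> has law \<open>\<alpha>\<close>, so expectations of functions of
  \<open>\<rho>\<close> are integrals against \<open>\<alpha>\<close>. As the integral of a non-integrable function is \<open>0\<close>, the
  first two conditions entail integrability of \<open>ln \<rho>\<close> and of \<open>\<rho>\<^sup>s\<close>; for uniformly elliptic
  \<open>\<alpha>\<close> both are bounded anyway.\<close>

definition s_transient :: "real \<Rightarrow> real measure \<Rightarrow> bool" where
  "s_transient s \<alpha> \<longleftrightarrow>
     (\<integral>w. ln (rho w) \<partial>\<alpha>) < 0 \<and>
     (\<integral>w. rho w powr s \<partial>\<alpha>) = 1 \<and>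
     (\<integral>\<^sup>+w. ennreal (rho w * max 0 (ln (rho w))) \<partial>\<alpha>) < \<infinity>"

definition env_law :: "real measure \<Rightarrow> (int \<Rightarrow> real) measure" where
  "env_law \<alpha> = Pi\<^sub>M UNIV (\<lambda>_. \<alpha>)"


section \<open>The random walk in a random environment\<close>

text \<open>\<open>bernoulli_pmf\<close> truncates its parameter to \<open>[0, 1]\<close>, which affects only a null set of
  environments.\<close>

definition step_pmf :: "(int \<Rightarrow> real) \<Rightarrow> int \<Rightarrow> int pmf" where
  "step_pmf \<omega> x = map_pmf (\<lambda>b. if b then x + 1 else x - 1) (bernoulli_pmf (\<omega> x))"

text \<open>The law of \<open>Z\<^sub>n\<close> given \<open>Z\<^sub>0, \<dots>, Z\<^sub>n\<^sub>-\<^sub>1\<close>.\<close>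

primrec walk_kernel :: "(int \<Rightarrow> real) \<Rightarrow> nat \<Rightarrow> (nat \<Rightarrow> int) \<Rightarrow> int pmf" where
  "walk_kernel \<omega> 0 z = return_pmf 0"
| "walk_kernel \<omega> (Suc n) z = step_pmf \<omega> (z n)"

abbreviation path_space :: "(nat \<Rightarrow> int) measure" where
  "path_space \<equiv> Pi\<^sub>M UNIV (\<lambda>_. count_space UNIV)"

interpretation walk: Ionescu_Tulcea
  "\<lambda>n z. measure_pmf (walk_kernel \<omega> n z)" "\<lambda>_. count_space UNIV" for \<omega>
proof
  fix i :: nat
  show "(\<lambda>z. measure_pmf (walk_kernel \<omega> i z))
      \<in> Pi\<^sub>M {0..<i} (\<lambda>_. count_space UNIV) \<rightarrow>\<^sub>M subprob_algebra (count_space UNIV)"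
  proof (cases i)
    case 0
    then show ?thesis by (simp add: measurable_measure_pmf measure_pmf_in_subprob_algebra)
  next
    case (Suc n)
    have "(\<lambda>z. z n) \<in> Pi\<^sub>M {0..<i} (\<lambda>_. count_space (UNIV :: int set)) \<rightarrow>\<^sub>M count_space UNIV"
      by (rule measurable_component_singleton) (simp add: Suc)
    from measurable_compose[OF this measurable_measure_pmf[of "step_pmf \<omega>"]]
    show ?thesis by (simp add: Suc)
  qed
qed

definition quenched_law :: "(int \<Rightarrow> real) \<Rightarrow> (nat \<Rightarrow> int) measure" where
  "quenched_law \<omega> = walk.PF.lim \<omega>"

definition annealed_law :: "real measure \<Rightarrow> (nat \<Rightarrow> int) measure" where
  "annealed_law \<alpha> = env_law \<alpha> \<bind> quenched_law"

lemma space_quenched_law [simp]: "space (quenched_law \<omega>) = UNIV"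
  by (simp add: quenched_law_def space_PiM)

lemma sets_quenched_law [simp, measurable_cong]: "sets (quenched_law \<omega>) = sets path_space"
  by (simp add: quenched_law_def)

definition cylinder :: "nat \<Rightarrow> (nat \<Rightarrow> int) \<Rightarrow> (nat \<Rightarrow> int) set" where
  "cylinder n x = {z. \<forall>i<n. z i = x i}"

lemma sets_cylinder [measurable]: "cylinder n x \<in> sets path_space"
proof -
  have "{z \<in> space path_space. \<forall>i\<in>{..<n}. z i = x i} \<in> sets path_space"
    by measurable
  then show ?thesis by (simp add: cylinder_def space_PiM Ball_def)
qed

lemma sets_finite_cylinder:
  fixes n :: nat and x :: "nat \<Rightarrow> int"
  shows "{z \<in> space (Pi\<^sub>M {0..<n} (\<lambda>_. count_space UNIV)). \<forall>i<n. z i = x i}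
     \<in> sets (Pi\<^sub>M {0..<n} (\<lambda>_. count_space UNIV))"
proof -
  have "{z \<in> space (Pi\<^sub>M {0..<n} (\<lambda>_. count_space UNIV)). \<forall>i\<in>{0..<n}. z i = x i}
     \<in> sets (Pi\<^sub>M {0..<n} (\<lambda>_. count_space UNIV))"
  proof (rule sets.sets_Collect_finite_All)
    fix i assume "i \<in> {0..<n}"
    then have "(\<lambda>z. z i) \<in> Pi\<^sub>M {0..<n} (\<lambda>_. count_space (UNIV :: int set)) \<rightarrow>\<^sub>M count_space UNIV"
      by (rule measurable_component_singleton)
    from measurable_sets[OF this, of "{x i}"]
    show "{z \<in> space (Pi\<^sub>M {0..<n} (\<lambda>_. count_space UNIV)). z i = x i}
        \<in> sets (Pi\<^sub>M {0..<n} (\<lambda>_. count_space UNIV))"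
      by (simp add: vimage_def Int_def conj_commute)
  qed simp
  then show ?thesis by (simp add: Ball_def)
qed

lemma walk_kernel_cong: "(\<And>i. i < n \<Longrightarrow> z i = x i) \<Longrightarrow> walk_kernel \<omega> n z = walk_kernel \<omega> n x"
  by (cases n) auto

lemma emeasure_walk_C:
  "emeasure (walk.C \<omega> 0 n (\<lambda>_. undefined))
     {z \<in> space (Pi\<^sub>M {0..<n} (\<lambda>_. count_space UNIV)). \<forall>i<n. z i = x i} =
   (\<Prod>i<n. ennreal (pmf (walk_kernel \<omega> i x) (x i)))"
proof (induction n)
  case 0
  have "{\<lambda>_. undefined} \<in> sets (Pi\<^sub>M ({} :: nat set) (\<lambda>_. count_space (UNIV :: int set)))"
    by (simp add: sets_PiM_empty)
  then show ?case by (simp add: space_PiM)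
next
  case (Suc n)
  let ?S = "\<lambda>n. Pi\<^sub>M {0..<n} (\<lambda>_. count_space (UNIV :: int set))"
  let ?A = "\<lambda>n. {z \<in> space (?S n). \<forall>i<n. z i = x i}"
  let ?C = "walk.C \<omega> 0 n (\<lambda>_. undefined)"
  have u: "(\<lambda>_. undefined) \<in> space (?S 0)"
    by (simp add: space_PiM PiE_def extensional_def)
  have sp: "space ?C = space (?S n)"
    using walk.space_C[OF u] by simp
  have st: "sets ?C = sets (?S n)"
    using walk.sets_C[OF u] by simp
  have e: "emeasure (walk.eP \<omega> n z) (?A (Suc n)) =
      ennreal (pmf (walk_kernel \<omega> n x) (x n)) * indicator (?A n) z" if z: "z \<in> space ?C" for z
  proof -
    have z': "z \<in> space (?S n)"
      using z by (simp add: sp)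
    have "emeasure (walk.eP \<omega> n z) (?A (Suc n)) =
        emeasure (walk_kernel \<omega> n z) (fun_upd z n -` ?A (Suc n) \<inter> space (count_space UNIV))"
      by (rule walk.emeasure_eP[OF z' sets_finite_cylinder])
    also have "fun_upd z n -` ?A (Suc n) \<inter> space (count_space UNIV) =
        (if z \<in> ?A n then {x n} else {})"
      using z' by (auto simp: space_PiM PiE_iff extensional_def less_Suc_eq)
    also have "emeasure (walk_kernel \<omega> n z) \<dots> =
      ennreal (pmf (walk_kernel \<omega> n x) (x n)) * indicator (?A n) z"
      using walk_kernel_cong[of n z x \<omega>] by (auto simp: emeasure_pmf_single)
    finally show ?thesis .
  qed
  have k: "walk.eP \<omega> n \<in> ?C \<rightarrow>\<^sub>M subprob_algebra (?S (Suc n))"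
    using walk.measurable_eP[of \<omega> n] by (simp cong: measurable_cong_sets add: st)
  have "emeasure (walk.C \<omega> 0 (Suc n) (\<lambda>_. undefined)) (?A (Suc n)) =
      (\<integral>\<^sup>+z. emeasure (walk.eP \<omega> n z) (?A (Suc n)) \<partial>?C)"
    unfolding walk.C.simps add_0
    by (rule emeasure_bind[OF _ k sets_finite_cylinder]) (simp add: sp)
  also have "\<dots> = (\<integral>\<^sup>+z. ennreal (pmf (walk_kernel \<omega> n x) (x n)) * indicator (?A n) z \<partial>?C)"
    by (rule nn_integral_cong) (rule e)
  also have "\<dots> = ennreal (pmf (walk_kernel \<omega> n x) (x n)) * emeasure ?C (?A n)"
    by (rule nn_integral_cmult_indicator) (simp add: st sets_finite_cylinder)
  finally show ?case
    by (simp add: Suc.IH mult.commute)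
qed

lemma emeasure_quenched_law_cylinder:
  "emeasure (quenched_law \<omega>) (cylinder n x) = (\<Prod>i<n. ennreal (pmf (walk_kernel \<omega> i x) (x i)))"
proof -
  let ?S = "Pi\<^sub>M {0..<n} (\<lambda>_. count_space (UNIV :: int set))"
  let ?A = "{z \<in> space ?S. \<forall>i<n. z i = x i}"
  have "cylinder n x = prod_emb UNIV (\<lambda>_. count_space UNIV) {0..<n} ?A"
    by (auto simp: cylinder_def prod_emb_def space_PiM)
  then have "emeasure (quenched_law \<omega>) (cylinder n x) = emeasure (walk.CI \<omega> {0..<n}) ?A"
    unfolding quenched_law_def by (simp only: walk.lim[OF finite_atLeastLessThan sets_finite_cylinder])
  also have "\<dots> = emeasure (walk.C \<omega> 0 n (\<lambda>_. undefined))
      (prod_emb {0..<n} (\<lambda>_. count_space UNIV) {0..<n} ?A)"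
    by (rule walk.emeasure_CI[OF subset_refl sets_finite_cylinder])
  also have "prod_emb {0..<n} (\<lambda>_. count_space UNIV) {0..<n} ?A = ?A"
    by (rule prod_emb_id) (auto simp: space_PiM)
  finally show ?thesis
    by (simp only: emeasure_walk_C)
qed

text \<open>The quenched law is that of the Markov chain started at \<open>0\<close> with the prescribed
  transition probabilities.\<close>

corollary quenched_law_markov:
  assumes "\<And>y. \<omega> y \<in> {0..1}"
  shows "measure (quenched_law \<omega>) (cylinder (Suc n) x) =
    (if x 0 = 0 then 1 else 0) *
    (\<Prod>i<n. if x (Suc i) = x i + 1 then \<omega> (x i)
           else if x (Suc i) = x i - 1 then 1 - \<omega> (x i) else 0)"
proof -
  have vim: "(\<lambda>b. if b then y + 1 else y - 1) -` {z} =
      (if z = y + 1 then {True} else if z = y - 1 then {False} else {})" for y z :: int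
    by (auto split: if_splits)
  have "pmf (step_pmf \<omega> y) z =
      (if z = y + 1 then \<omega> y else if z = y - 1 then 1 - \<omega> y else 0)" for y z
    using assms[of y] by (simp add: step_pmf_def pmf_map vim measure_pmf_single)
  then show ?thesis
    unfolding measure_def emeasure_quenched_law_cylinder prod.lessThan_Suc_shift
    using assms by (simp add: prod_ennreal prod_nonneg pmf_return indicator_def)
qed

lemma prob_space_quenched_law: "prob_space (quenched_law \<omega>)"
proof
  show "emeasure (quenched_law \<omega>) (space (quenched_law \<omega>)) = 1"
    using emeasure_quenched_law_cylinder[of \<omega> 0] by (simp add: cylinder_def)
qed

lemma sets_path_space_cylinder:
  "sets path_space = sigma_sets UNIV (insert {} (range (\<lambda>xs. cylinder (length xs) ((!) xs))))"
    (is "_ = sigma_sets UNIV ?G")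
proof (rule antisym)
  have "{z. z i \<in> A} \<in> sigma_sets UNIV ?G" for i :: nat and A :: "int set"
  proof -
    let ?L = "{xs. length xs = Suc i \<and> xs ! i \<in> A}"
    have "{z. z i \<in> A} = (\<Union>xs\<in>?L. cylinder (length xs) ((!) xs))"
    proof (safe, goal_cases)
      case (1 z)
      then show ?case
        by (intro UN_I[of "map z [0..<Suc i]"])
          (auto simp: cylinder_def nth_append less_Suc_eq simp del: upt_Suc)
    qed (auto simp: cylinder_def)
    moreover have "(\<Union>xs\<in>?L. cylinder (length xs) ((!) xs)) \<in> sigma_sets UNIV ?G"
    proof (rule sigma_sets_UNION)
      show "countable ((\<lambda>xs. cylinder (length xs) ((!) xs)) ` ?L)"
        by simp
      show "B \<in> sigma_sets UNIV ?G" if "B \<in> (\<lambda>xs. cylinder (length xs) ((!) xs)) ` ?L" for B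
        using that by (blast intro: sigma_sets.Basic)
    qed
    ultimately show ?thesis by simp
  qed
  then show "sets path_space \<subseteq> sigma_sets UNIV ?G"
    unfolding sets_PiM_single space_count_space PiE_UNIV_domain Pi_UNIV
    by (intro sigma_sets_mono subsetI) (elim CollectE exE conjE, simp)
next
  have "sigma_sets (space path_space) ?G \<subseteq> sets path_space"
    by (rule sets.sigma_sets_subset) auto
  then show "sigma_sets UNIV ?G \<subseteq> sets path_space"
    by (simp add: space_PiM)
qed

lemma measurable_quenched_law [measurable]:
  "quenched_law \<in> Pi\<^sub>M UNIV (\<lambda>_. borel) \<rightarrow>\<^sub>M subprob_algebra path_space"
proof (rule measurable_subprob_algebra_generated[OF sets_path_space_cylinder])
  let ?G = "insert {} (range (\<lambda>xs. cylinder (length xs) ((!) xs)))"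
  show "Int_stable ?G"
  proof -
    have *: "cylinder (length xs) ((!) xs) \<inter> cylinder (length ys) ((!) ys) \<in> ?G"
      if "length xs \<le> length ys" for xs ys
    proof (cases "\<forall>i<length xs. xs ! i = ys ! i")
      case True
      with that have "cylinder (length xs) ((!) xs) \<inter> cylinder (length ys) ((!) ys) =
          cylinder (length ys) ((!) ys)"
        by (auto simp: cylinder_def)
      then show ?thesis by auto
    next
      case False
      with that have "cylinder (length xs) ((!) xs) \<inter> cylinder (length ys) ((!) ys) = {}"
        unfolding cylinder_def using order.strict_trans2[OF _ that] by force
      then show ?thesis by auto
    qed
    show ?thesis
      unfolding Int_stable_def
    proof (intro ballI)
      fix A B assume "A \<in> ?G" "B \<in> ?G"
      then consider "A \<inter> B = {}" | xs ys where "A = cylinder (length xs) ((!) xs)"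
          "B = cylinder (length ys) ((!) ys)"
        by blast
      then show "A \<inter> B \<in> ?G"
      proof cases
        case (2 xs ys)
        show ?thesis
        proof (cases "length xs \<le> length ys")
          case True
          then show ?thesis unfolding 2 by (rule *)
        next
          case False
          then have "length ys \<le> length xs" by simp
          from *[OF this] show ?thesis unfolding 2 by (simp only: Int_commute)
        qed
      qed simp
    qed
  qed
  show "?G \<subseteq> Pow UNIV" by simp
  show "subprob_space (quenched_law \<omega>)" for \<omega>
    by (intro prob_space_imp_subprob_space prob_space_quenched_law)
  show "sets (quenched_law \<omega>) = sets path_space" for \<omega>
    by simp
  have step: "(\<lambda>\<omega>. pmf (step_pmf \<omega> y) z) \<in> borel_measurable (Pi\<^sub>M UNIV (\<lambda>_. borel))" for y z
  proof -
    have vim: "(\<lambda>b. if b then y + 1 else y - 1) -` {z} =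
        (if z = y + 1 then {True} else if z = y - 1 then {False} else {})"
      by (auto split: if_splits)
    have "(\<lambda>\<omega>. pmf (bernoulli_pmf (\<omega> y)) b) \<in> borel_measurable (Pi\<^sub>M UNIV (\<lambda>_. borel))" for b
      by (simp add: bernoulli_pmf.rep_eq)
    then show ?thesis
      by (simp add: step_pmf_def pmf_map vim measure_pmf_single)
  qed
  have "(\<lambda>\<omega>. pmf (walk_kernel \<omega> i x) (x i)) \<in> borel_measurable (Pi\<^sub>M UNIV (\<lambda>_. borel))" for i x
    by (cases i) (simp_all add: step)
  then show "(\<lambda>\<omega>. emeasure (quenched_law \<omega>) A) \<in> borel_measurable (Pi\<^sub>M UNIV (\<lambda>_. borel))"
    if "A \<in> ?G" for A
    using that by (auto simp: emeasure_quenched_law_cylinder)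
  show "(\<lambda>\<omega>. emeasure (quenched_law \<omega>) UNIV) \<in> borel_measurable (Pi\<^sub>M UNIV (\<lambda>_. borel))"
    using prob_space.emeasure_space_1[OF prob_space_quenched_law] by simp
qed

lemma prob_space_env_law: "env_distribution \<alpha> \<Longrightarrow> prob_space (env_law \<alpha>)"
  unfolding env_law_def env_distribution_def by (intro prob_space_PiM) simp

lemma sets_env_law: "env_distribution \<alpha> \<Longrightarrow> sets (env_law \<alpha>) = sets (Pi\<^sub>M UNIV (\<lambda>_. borel))"
  unfolding env_law_def env_distribution_def by (intro sets_PiM_cong) auto

lemma measurable_quenched_law_env_law:
  "env_distribution \<alpha> \<Longrightarrow> quenched_law \<in> env_law \<alpha> \<rightarrow>\<^sub>M subprob_algebra path_space"
  using measurable_quenched_law measurable_cong_sets[OF sets_env_law refl] by blast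

lemma prob_space_annealed_law: "env_distribution \<alpha> \<Longrightarrow> prob_space (annealed_law \<alpha>)"
  unfolding annealed_law_def
  by (intro prob_space.prob_space_bind[OF prob_space_env_law _ measurable_quenched_law_env_law])
    (simp_all add: prob_space_quenched_law)

lemma sets_annealed_law:
  assumes "env_distribution \<alpha>"
  shows "sets (annealed_law \<alpha>) = sets path_space"
  unfolding annealed_law_def
  by (rule sets_bind) (use prob_space.not_empty[OF prob_space_env_law[OF assms]] in simp_all)

lemma emeasure_annealed_law:
  assumes "env_distribution \<alpha>" "A \<in> sets path_space"
  shows "emeasure (annealed_law \<alpha>) A = (\<integral>\<^sup>+\<omega>. emeasure (quenched_law \<omega>) A \<partial>env_law \<alpha>)"
  unfolding annealed_law_def
  using prob_space.not_empty[OF prob_space_env_law[OF assms(1)]]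
    measurable_quenched_law_env_law[OF assms(1)] assms(2)
  by (rule emeasure_bind)


section \<open>Speed, fluctuations and convergence\<close>

definition speed :: "real measure \<Rightarrow> real" where
  "speed \<alpha> = (1 - (\<integral>w. rho w \<partial>\<alpha>)) / (1 + (\<integral>w. rho w \<partial>\<alpha>))"

definition scaled_walk :: "real measure \<Rightarrow> real \<Rightarrow> nat \<Rightarrow> (nat \<Rightarrow> int) \<Rightarrow> real" where
  "scaled_walk \<alpha> \<sigma> n z = (of_int (z n) - speed \<alpha> * real n) / (\<sigma> * sqrt (real n))"

lemma measurable_scaled_walk:
  assumes "env_distribution \<alpha>"
  shows "scaled_walk \<alpha> \<sigma> n \<in> borel_measurable (annealed_law \<alpha>)"
proof -
  have "scaled_walk \<alpha> \<sigma> n \<in> borel_measurable path_space"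
    unfolding scaled_walk_def by measurable
  then show ?thesis
    using measurable_cong_sets[OF sets_annealed_law[OF assms] refl] by blast
qed

text \<open>The defining property of the diffusion constant \<open>\<sigma>\<^sub>s\<close>; by convergence of types it
  determines \<open>\<sigma>\<close> uniquely.\<close>

definition is_diffusion_constant :: "real measure \<Rightarrow> real \<Rightarrow> bool" where
  "is_diffusion_constant \<alpha> \<sigma> \<longleftrightarrow> 0 < \<sigma> \<and>
     weak_conv_m (\<lambda>n. distr (annealed_law \<alpha>) borel (scaled_walk \<alpha> \<sigma> n)) std_normal_distribution"

text \<open>Convergence in \<open>L\<^sup>p\<close> towards a random variable of which only the law \<open>N\<close> is specified.
  The moments are taken in \<open>[0, \<infinity>]\<close>.\<close>

definition Lp_converges_to_law ::
    "real \<Rightarrow> 'a measure \<Rightarrow> (nat \<Rightarrow> 'a \<Rightarrow> real) \<Rightarrow> real measure \<Rightarrow> bool" where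
  "Lp_converges_to_law p M W N \<longleftrightarrow>
     weak_conv_m (\<lambda>n. distr M borel (W n)) N \<and>
     (\<lambda>n. \<integral>\<^sup>+x. ennreal (\<bar>W n x\<bar> powr p) \<partial>M) \<longlonglongrightarrow> (\<integral>\<^sup>+y. ennreal (\<bar>y\<bar> powr p) \<partial>N) \<and>
     (\<integral>\<^sup>+y. ennreal (\<bar>y\<bar> powr p) \<partial>N) < \<infinity>"

end

theory Submission
  imports Defs
begin

text \<open>Convergence in law is given, so everything reduces to
  \<open>E \<bar>Z\<^sub>n - v n\<bar>\<^sup>q = O(n\<^sup>q\<^sup>/\<^sup>2)\<close> for one exponent \<open>q\<close> with \<open>max 2 p < q < s\<close>: then the
  \<open>p\<close>-th powers are uniformly integrable. Such \<open>q\<close> satisfy \<open>\<langle>\<rho>\<^sup>q\<rangle> < 1\<close>.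

  Let \<open>S(x) = x + h(x)\<close> be the harmonic coordinate, whose increments \<open>\<Delta>\<close> solve
  \<open>\<Delta>(x + 1) = v (1 + \<rho>(x)) + \<rho>(x) \<Delta>(x)\<close>; then \<open>S(Z\<^sub>n) - v n\<close> is a quenched martingale. Its
  \<open>q\<close>-th moment is bounded by \<open>n\<^sup>q\<^sup>/\<^sup>2\<^sup>-\<^sup>1\<close> times the expected sum of \<open>1 + \<Delta>\<^sup>q\<close> along the path, hence by
  the sum over \<open>\<bar>x\<bar> \<le> n\<close> of Green's function times \<open>1 + \<Delta>\<^sup>q\<close>. Green's function at \<open>x\<close> only looks
  at the environment to the right of \<open>x\<close> (inclusive) and \<open>\<Delta>(x)\<close> only to the left, so by independence
  this sum is \<open>O(n)\<close>. Finally \<open>h\<close> is, up to a factor and boundary terms, itself a martingale in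
  the i.i.d. environment, so that Doob's inequality bounds \<open>\<bar>h(Z\<^sub>n)\<bar> \<le> max\<^bsub>\<bar>x\<bar> \<le> n\<^esub> \<bar>h(x)\<bar>\<close>.\<close>

section \<open>Inequalities for real powers\<close>

text \<open>The increments of \<open>S\<close> have only moments of order below \<open>s\<close>,
  and they are read along a path that itself depends on the environment. In time, one elementary
  inequality for |a + b|^q, iterated by a discrete Gronwall argument, stands in for Burkholder's
  inequality with a constant depending on \<open>q\<close> alone, so that the quenched bound can be
  integrated over environments. In space, occupation is controlled by any nonnegative supersolution
  of the Green equation on [-n, n], and an explicit one is built from the right. As the walk stays
  in [-n, n] for n steps, both recursions may start just outside this window: no infinite series in
  the environment occurs, and after clipping every quantity is, for fixed n, a bounded function of
  the environment. That q >= 2 matters twice: for the second-order remainder in the inequality, and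
  for the estimate n <= n^(q/2) of the boundary terms of the corrector.\<close>

lemma powr_one_add_le_quadratic:
  fixes q :: real
  assumes q: "2 \<le> q"
  shows "\<exists>K\<ge>0. \<forall>t. \<bar>t\<bar> \<le> 1/2 \<longrightarrow> (1 + t) powr q \<le> 1 + q * t + K * t\<^sup>2"
proof (intro exI conjI allI impI)
  \<comment> \<open>An upper bound for half the second derivative of (1 + t)^q, since 1 + t <= 2.
    With it the difference \<open>f\<close> is convex with \<open>f 0 = f' 0 = 0\<close>, so its
    tangent at 0 is the zero function.\<close>
  let ?K = "q * (q - 1) * 2 powr (q - 2) / 2"
  show "?K \<ge> 0" using q by simp
  fix t :: real assume t: "\<bar>t\<bar> \<le> 1/2"
  define f where "f = (\<lambda>t. 1 + q * t + ?K * t\<^sup>2 - (1 + t) powr q)"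
  define f' where "f' = (\<lambda>t. q + ?K * (2 * t) - q * (1 + t) powr (q - 1))"
  define f'' where "f'' = (\<lambda>t. ?K * 2 - q * ((q - 1) * (1 + t) powr (q - 2)))"
  have d1: "(f has_real_derivative f' x) (at x)" if "x \<in> {-1/2..1/2}" for x
    using that unfolding f_def f'_def
    by (auto intro!: derivative_eq_intros DERIV_fun_powr)
  have d2: "(f' has_real_derivative f'' x) (at x)" if "x \<in> {-1/2..1/2}" for x
    using that unfolding f'_def f''_def
    by (auto intro!: derivative_eq_intros DERIV_fun_powr simp: diff_diff_eq)
  have nn: "f'' x \<ge> 0" if "x \<in> {-1/2..1/2}" for x
  proof -
    have "(1 + x) powr (q - 2) \<le> 2 powr (q - 2)"
      using that q by (intro powr_mono2) auto
    then have "q * (q - 1) * (1 + x) powr (q - 2) \<le> q * (q - 1) * 2 powr (q - 2)"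
      using q by (intro mult_left_mono) auto
    then show ?thesis unfolding f''_def by linarith
  qed
  have cvx: "convex_on {-1/2..1/2} f"
    by (rule f''_ge0_imp_convex[OF _ d1 d2 nn]) auto
  have "f t - f 0 \<ge> f' 0 * (t - 0)"
    by (rule convex_on_imp_above_tangent[OF cvx])
      (use t in \<open>auto intro!: has_field_derivative_at_within d1\<close>)
  then show "(1 + t) powr q \<le> 1 + q * t + ?K * t\<^sup>2"
    by (simp add: f_def f'_def)
qed

text \<open>The two terms on the right balance at a = sqrt N * b, the typical ratio between a sum of
  N centred increments and a single one. The side of this scale on which \<open>a\<close> lies
  decides which term dominates.\<close>

lemma powr_mult_power2_le:
  fixes a b N q :: real
  assumes q: "2 \<le> q" and N: "0 < N" and ab: "0 \<le> a" "0 \<le> b"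
  shows "a powr (q - 2) * b\<^sup>2 \<le> a powr q / N + N powr (q/2 - 1) * b powr q"
proof (cases "N * b\<^sup>2 \<le> a\<^sup>2")
  case True
  then have "b\<^sup>2 \<le> a\<^sup>2 / N" using N by (simp add: field_simps)
  then have "a powr (q - 2) * b\<^sup>2 \<le> a powr (q - 2) * (a\<^sup>2 / N)"
    by (intro mult_left_mono) auto
  also have "\<dots> = a powr q / N"
    using ab q by (cases "a = 0") (simp_all add: powr_diff powr_numeral)
  finally show ?thesis using N by (simp add: add_increasing2)
next
  case False
  then have b: "b > 0" using ab N by (cases "b = 0") auto
  have "a powr (q - 2) = (a\<^sup>2) powr ((q - 2)/2)"
  proof (cases "a = 0")
    case False
    then have "(a\<^sup>2) powr ((q - 2)/2) = (a powr 2) powr ((q - 2)/2)"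
      using ab by (simp add: powr_numeral)
    moreover have "2 * ((q - 2)/2) = q - 2" by simp
    ultimately show ?thesis by (simp only: powr_powr)
  qed simp
  also have "\<dots> \<le> (N * b\<^sup>2) powr ((q - 2)/2)"
    using False q by (intro powr_mono2) auto
  also have "\<dots> = N powr (q/2 - 1) * b powr (q - 2)"
  proof -
    have "(N * b\<^sup>2) powr ((q - 2)/2) = N powr ((q - 2)/2) * (b powr 2) powr ((q - 2)/2)"
      using b N by (simp add: powr_mult powr_numeral)
    then show ?thesis by (simp add: powr_powr diff_divide_distrib)
  qed
  finally have "a powr (q - 2) * b\<^sup>2 \<le> N powr (q/2 - 1) * b powr (q - 2) * b\<^sup>2"
    by (rule mult_right_mono) simp
  also have "\<dots> = N powr (q/2 - 1) * b powr q"
    using b by (simp add: powr_diff powr_numeral)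
  finally show ?thesis using N by (simp add: add_increasing)
qed

text \<open>With \<open>a\<close> a martingale at time \<open>k < N\<close> and \<open>b\<close> its next increment, the linear term has mean
  zero; the weight \<open>1/N\<close> is what makes the bound summable over \<open>N\<close> steps.\<close>

lemma abs_powr_add_le_linearised:
  fixes q :: real
  assumes q: "2 \<le> q"
  obtains C where "0 \<le> C" and "\<And>a b N. 1 \<le> N \<Longrightarrow> \<bar>a + b\<bar> powr q \<le>
    \<bar>a\<bar> powr q + q * sgn a * \<bar>a\<bar> powr (q - 1) * b
      + C * (\<bar>a\<bar> powr q / N + N powr (q/2 - 1) * \<bar>b\<bar> powr q)"
proof -
  obtain K where K: "K \<ge> 0" "\<And>t. \<bar>t\<bar> \<le> 1/2 \<Longrightarrow> (1 + t) powr q \<le> 1 + q * t + K * t\<^sup>2"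
    using powr_one_add_le_quadratic[OF q] by blast
  \<comment> \<open>\<open>K\<close> pays for the Taylor remainder when |b| <= a/2. Otherwise a <=
    2|b|: then |a + b| <= 3|b| yields 3^q, and the possibly negative linear term yields q * 2^(q-1).
    Negative \<open>a\<close> are reduced to this by changing both signs.\<close>
  define C where "C = K + 3 powr q + q * 2 powr (q - 1)"
  have C0: "C \<ge> 0" using K q by (simp add: C_def)
  have pos: "\<bar>a + b\<bar> powr q \<le> a powr q + q * a powr (q - 1) * b
      + C * (a powr q / N + N powr (q/2 - 1) * \<bar>b\<bar> powr q)"
    if a: "0 \<le> a" and N: "1 \<le> N" for a b N :: real
  proof (cases "\<bar>b\<bar> \<le> a / 2 \<and> 0 < a")
    case True
    define t where "t = b / a"
    have t: "\<bar>t\<bar> \<le> 1/2" "b = a * t" using True by (auto simp: t_def field_simps)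
    have "\<bar>a + b\<bar> powr q = a powr q * (1 + t) powr q"
    proof -
      have "a + b = a * (1 + t)" "0 \<le> 1 + t" using t by (auto simp: algebra_simps)
      then show ?thesis using a by (simp add: abs_mult powr_mult)
    qed
    also have "\<dots> \<le> a powr q * (1 + q * t + K * t\<^sup>2)"
      by (intro mult_left_mono K t) simp
    also have "\<dots> = a powr q + q * a powr (q - 1) * b + K * (a powr (q - 2) * \<bar>b\<bar>\<^sup>2)"
      using True unfolding t(2) by (simp add: powr_diff powr_numeral algebra_simps power2_eq_square)
    also have "K * (a powr (q - 2) * \<bar>b\<bar>\<^sup>2) \<le> K * (a powr q / N + N powr (q/2 - 1) * \<bar>b\<bar> powr q)"
      using N a q K by (intro mult_left_mono powr_mult_power2_le) auto
    also have "\<dots> \<le> C * (a powr q / N + N powr (q/2 - 1) * \<bar>b\<bar> powr q)"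
      using N q by (intro mult_right_mono) (auto simp: C_def)
    finally show ?thesis by simp
  next
    case False
    then have ab: "a \<le> 2 * \<bar>b\<bar>" using a by auto
    have "\<bar>a + b\<bar> powr q \<le> (3 * \<bar>b\<bar>) powr q"
      using ab a q by (intro powr_mono2) auto
    also have "\<dots> = 3 powr q * \<bar>b\<bar> powr q" by (simp add: powr_mult)
    finally have 1: "\<bar>a + b\<bar> powr q \<le> 3 powr q * \<bar>b\<bar> powr q" .
    have "- (q * a powr (q - 1) * b) \<le> q * a powr (q - 1) * \<bar>b\<bar>"
    proof -
      have "(q * a powr (q - 1)) * - b \<le> (q * a powr (q - 1)) * \<bar>b\<bar>"
        using q by (intro mult_left_mono) auto
      then show ?thesis by simp
    qed
    also have "\<dots> \<le> q * (2 * \<bar>b\<bar>) powr (q - 1) * \<bar>b\<bar>"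
      using q a ab by (intro mult_left_mono mult_right_mono powr_mono2) auto
    also have "\<dots> = q * 2 powr (q - 1) * \<bar>b\<bar> powr q"
      by (cases "b = 0") (simp_all add: powr_mult powr_diff)
    finally have 2: "- (q * a powr (q - 1) * b) \<le> q * 2 powr (q - 1) * \<bar>b\<bar> powr q" .
    have "3 powr q * \<bar>b\<bar> powr q + q * 2 powr (q - 1) * \<bar>b\<bar> powr q \<le> C * \<bar>b\<bar> powr q"
      using K by (simp add: C_def algebra_simps)
    also have "\<dots> \<le> C * (a powr q / N + N powr (q/2 - 1) * \<bar>b\<bar> powr q)"
    proof (intro mult_left_mono C0)
      have "1 * \<bar>b\<bar> powr q \<le> N powr (q/2 - 1) * \<bar>b\<bar> powr q"
        using N q by (intro mult_right_mono ge_one_powr_ge_zero) auto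
      then show "\<bar>b\<bar> powr q \<le> a powr q / N + N powr (q/2 - 1) * \<bar>b\<bar> powr q"
        using N by (simp add: add_increasing)
    qed
    finally show ?thesis using 1 2 powr_ge_zero[of a q] by linarith
  qed
  show thesis
  proof (rule that[OF C0])
    fix a b N :: real assume N: "1 \<le> N"
    show "\<bar>a + b\<bar> powr q \<le> \<bar>a\<bar> powr q + q * sgn a * \<bar>a\<bar> powr (q - 1) * b
      + C * (\<bar>a\<bar> powr q / N + N powr (q/2 - 1) * \<bar>b\<bar> powr q)"
    proof (cases "0 \<le> a")
      case True
      then show ?thesis using pos[OF True N, of b] by (cases "a = 0") auto
    next
      case False
      then have "\<bar>- a + - b\<bar> = \<bar>a + b\<bar>" by simp
      then show ?thesis using pos[of "-a" N "-b"] False N by simp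
    qed
  qed
qed

text \<open>The coefficient of a^q can be brought as close to 1 as desired at the price of a large
  \<open>C\<close>. A contraction in the first summand thus stays a contraction, which the factor
  2^q of \<open>powr_add_le\<close> would destroy.\<close>

lemma powr_add_le_weighted:
  fixes q \<epsilon> :: real
  assumes q: "0 < q" and e: "0 < \<epsilon>"
  obtains C where "0 \<le> C"
    and "\<And>a b. 0 \<le> a \<Longrightarrow> 0 \<le> b \<Longrightarrow> (a + b) powr q \<le> (1 + \<epsilon>) * a powr q + C * b powr q"
proof -
  define d where "d = (1 + \<epsilon>) powr (1/q) - 1"
  have "(1 + \<epsilon>) powr (1/q) > 1" using q e by (simp add: gr_one_powr)
  then have d: "d > 0" by (simp add: d_def)
  have dq: "(1 + d) powr q = 1 + \<epsilon>" using q e by (simp add: d_def powr_powr)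
  show thesis
  proof (rule that[of "(1 + 1/d) powr q"])
    fix a b :: real assume ab: "0 \<le> a" "0 \<le> b"
    show "(a + b) powr q \<le> (1 + \<epsilon>) * a powr q + (1 + 1/d) powr q * b powr q"
    proof (cases "b \<le> d * a")
      case True
      then have "(a + b) powr q \<le> ((1 + d) * a) powr q"
        using ab q by (intro powr_mono2) (auto simp: algebra_simps)
      also have "\<dots> = (1 + \<epsilon>) * a powr q" using ab d by (simp add: powr_mult dq)
      finally show ?thesis by (simp add: add_increasing2)
    next
      case False
      then have "a + b \<le> (1 + 1/d) * b" using d by (simp add: field_simps)
      then have "(a + b) powr q \<le> ((1 + 1/d) * b) powr q"
        using ab q by (intro powr_mono2) auto
      also have "\<dots> = (1 + 1/d) powr q * b powr q" using ab d by (simp add: powr_mult)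
      finally show ?thesis using e by (simp add: add_increasing)
    qed
  qed simp
qed

lemma powr_add_le:
  fixes a b q :: real
  assumes "0 \<le> q" "0 \<le> a" "0 \<le> b"
  shows "(a + b) powr q \<le> 2 powr q * (a powr q + b powr q)"
proof -
  have "(a + b) powr q \<le> (2 * max a b) powr q"
    using assms by (intro powr_mono2) auto
  also have "\<dots> = 2 powr q * max a b powr q" using assms by (simp add: powr_mult)
  also have "max a b powr q \<le> a powr q + b powr q" by (simp add: max_def)
  finally show ?thesis by simp
qed

text \<open>The growth rate is tied to the horizon \<open>n\<close>, so that n steps compound to at
  most (1 + C/n)^n <= exp C. For this reason the linearised inequality is later applied with
  \<open>N\<close> equal to the final time, not the current one.\<close>

lemma discrete_gronwall:
  fixes x y :: "nat \<Rightarrow> real" and C :: real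
  assumes C: "0 \<le> C" and y: "\<And>k. 0 \<le> y k" and x0: "x 0 = 0"
    and step: "\<And>k. k < n \<Longrightarrow> x (Suc k) \<le> (1 + C / n) * x k + y k"
  shows "x n \<le> exp C * (\<Sum>k<n. y k)"
proof (cases "n = 0")
  case False
  have "x k \<le> (1 + C / n) ^ k * (\<Sum>j<k. y j)" if "k \<le> n" for k
    using that
  proof (induction k)
    case (Suc k)
    have "x (Suc k) \<le> (1 + C / n) * x k + y k" using Suc by (intro step) simp
    also have "\<dots> \<le> (1 + C / n) * ((1 + C / n) ^ k * (\<Sum>j<k. y j)) + (1 + C / n) ^ Suc k * y k"
      using Suc C y[of k] mult_right_mono[OF one_le_power[of "1 + C / n" "Suc k"] y[of k]]
      by (intro add_mono mult_left_mono) auto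
    also have "\<dots> = (1 + C / n) ^ Suc k * (\<Sum>j<Suc k. y j)" by (simp add: distrib_left mult.assoc)
    finally show ?case .
  qed (simp add: x0)
  from this[of n] have "x n \<le> (1 + C / n) ^ n * (\<Sum>j<n. y j)" by simp
  also have "\<dots> \<le> exp C * (\<Sum>j<n. y j)"
    using False C y by (intro mult_right_mono exp_ge_one_plus_x_over_n_power_n sum_nonneg) auto
  finally show ?thesis .
qed (simp add: x0)

lemma powr_tangent_le:
  fixes q x y :: real
  assumes q: "1 < q" and x: "0 \<le> x" and xy: "x \<le> y"
  shows "x powr q + q * x powr (q - 1) * (y - x) \<le> y powr q"
proof (cases "x = 0")
  case False
  with x have x: "x > 0" by simp
  have "x powr q + q * x powr (q - 1) * (y - x) \<le> y powr q" if "y > x"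
  proof -
    have "y powr q - x powr q \<ge> (q * x powr (q - 1)) * (y - x)"
      by (rule convex_on_imp_above_tangent[OF powr_convex[of q]])
        (use q x that in \<open>auto simp: interior_open intro!: has_field_derivative_at_within has_real_derivative_powr\<close>)
    then show ?thesis by simp
  qed
  then show ?thesis using xy by (cases "x = y") auto
qed (use q in auto)

section \<open>Quenched expectations\<close>

text \<open>The quenched expectation of \<open>f(Z\<^sub>k)\<close>; only the one-dimensional marginals of the walk matter.\<close>

primrec quenched_mean :: "(int \<Rightarrow> real) \<Rightarrow> nat \<Rightarrow> (int \<Rightarrow> real) \<Rightarrow> real" where
  "quenched_mean w 0 f = f 0"
| "quenched_mean w (Suc k) f = quenched_mean w k (\<lambda>x. w x * f (x + 1) + (1 - w x) * f (x - 1))"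

section \<open>Laws of finite paths and marginals of the walk\<close>

primrec path_pmf :: "(int \<Rightarrow> real) \<Rightarrow> nat \<Rightarrow> int list pmf" where
  "path_pmf w 0 = return_pmf [0]"
| "path_pmf w (Suc n) =
    bind_pmf (path_pmf w n) (\<lambda>xs. map_pmf (\<lambda>y. xs @ [y]) (step_pmf w (last xs)))"

lemma length_path_pmf: "xs \<in> set_pmf (path_pmf w n) \<Longrightarrow> length xs = Suc n"
  by (induction n arbitrary: xs) auto

lemma pmf_path_pmf:
  assumes "length xs = Suc n"
  shows "ennreal (pmf (path_pmf w n) xs) = emeasure (quenched_law w) (cylinder (Suc n) ((!) xs))"
  using assms
proof (induction n arbitrary: xs)
  case 0
  then obtain x where "xs = [x]" by (auto simp: length_Suc_conv)
  then show ?case by (simp add: emeasure_quenched_law_cylinder pmf_return indicator_def)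
next
  case (Suc n)
  then obtain ys y where xs: "xs = ys @ [y]" and len: "length ys = Suc n"
    by (metis length_append_singleton nat.inject rev_exhaust list.size(3) nat.distinct(1))
  have inj: "pmf (map_pmf (\<lambda>y. zs @ [y]) p) (ys @ [y]) = indicator {ys} zs * pmf p y" for zs p
  proof (cases "zs = ys")
    case True
    then show ?thesis
      using pmf_map_inj'[of "\<lambda>y. ys @ [y]" p y] by (simp add: inj_def)
  next
    case False
    then have "(\<lambda>y. zs @ [y]) -` {ys @ [y]} = {}" by auto
    then show ?thesis using False by (simp add: pmf_map)
  qed
  have "ennreal (pmf (path_pmf w (Suc n)) xs) =
      (\<integral>\<^sup>+zs. ennreal (pmf (step_pmf w (last ys)) y) * indicator {ys} zs \<partial>path_pmf w n)"
    unfolding path_pmf.simps ennreal_pmf_bind xs inj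
    by (intro nn_integral_cong) (auto simp: indicator_def)
  also have "\<dots> = ennreal (pmf (path_pmf w n) ys) * ennreal (pmf (step_pmf w (last ys)) y)"
    by (subst nn_integral_cmult_indicator) (auto simp: emeasure_pmf_single mult.commute)
  also have "\<dots> = (\<Prod>i<Suc (Suc n). ennreal (pmf (walk_kernel w i ((!) xs)) (xs ! i)))"
  proof -
    \<comment> \<open>Beyond its length \<open>ys ! i\<close> is unspecified; the kernels agree
      because step \<open>i\<close> consults only positions below \<open>i\<close>.\<close>
    have "walk_kernel w i ((!) ys) = walk_kernel w i ((!) xs)" if "i < Suc n" for i
      using that len by (intro walk_kernel_cong) (auto simp: xs nth_append)
    then have "(\<Prod>i<Suc n. ennreal (pmf (walk_kernel w i ((!) ys)) (ys ! i))) =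
        (\<Prod>i<Suc n. ennreal (pmf (walk_kernel w i ((!) xs)) (xs ! i)))"
      using len by (intro prod.cong) (auto simp: xs nth_append)
    moreover have "ys \<noteq> []" using len by auto
    then have "last ys = xs ! n" "y = xs ! Suc n"
      using len by (auto simp: xs nth_append last_conv_nth[of ys])
    ultimately show ?thesis
      using Suc.IH[OF len] by (simp add: emeasure_quenched_law_cylinder)
  qed
  finally show ?case by (simp add: emeasure_quenched_law_cylinder)
qed

lemma map_upt_eq_iff: "map z [0..<n] = xs \<longleftrightarrow> length xs = n \<and> (\<forall>i<n. z i = xs ! i)"
  by (subst list_eq_iff_nth_eq) auto

lemma map_upt_measurable:
  "(\<lambda>z. map z [0..<n]) \<in> path_space \<rightarrow>\<^sub>M count_space (UNIV :: int list set)"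
proof (subst measurable_count_space_eq2_countable)
  have "(\<lambda>z. map z [0..<n]) -` {xs} \<inter> space path_space =
      (if length xs = n then cylinder n ((!) xs) else {})" for xs :: "int list"
    by (auto simp: cylinder_def space_PiM map_upt_eq_iff)
  then show "(\<lambda>z. map z [0..<n]) \<in> space path_space \<rightarrow> UNIV \<and>
      (\<forall>xs\<in>UNIV. (\<lambda>z. map z [0..<n]) -` {xs} \<inter> space path_space \<in> sets path_space)"
    by auto
qed

text \<open>Both laws live on the countable set of lists, so single paths can be compared, and
  \<open>pmf_path_pmf\<close> gives their mass as that of a cylinder. This links the Ionescu-Tulcea
  limit to the recursion of \<open>quenched_mean\<close>.\<close>

lemma distr_quenched_law_path:
  "distr (quenched_law w) (count_space UNIV) (\<lambda>z. map z [0..<Suc n]) = measure_pmf (path_pmf w n)"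
proof (rule measure_eqI_countable[of _ UNIV])
  fix xs :: "int list"
  have m: "(\<lambda>z. map z [0..<Suc n]) \<in> quenched_law w \<rightarrow>\<^sub>M count_space UNIV"
    using map_upt_measurable by (simp cong: measurable_cong_sets del: upt_Suc)
  have "(\<lambda>z. map z [0..<Suc n]) -` {xs} =
      (if length xs = Suc n then cylinder (Suc n) ((!) xs) else {})"
    by (auto simp: cylinder_def map_upt_eq_iff simp del: upt_Suc)
  moreover have "emeasure (path_pmf w n) {xs} = 0" if "length xs \<noteq> Suc n"
    using that length_path_pmf[of xs w n] by (auto simp: emeasure_pmf_single set_pmf_iff)
  ultimately show "emeasure (distr (quenched_law w) (count_space UNIV) (\<lambda>z. map z [0..<Suc n])) {xs}
      = emeasure (path_pmf w n) {xs}"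
    by (subst emeasure_distr[OF m])
      (auto simp: emeasure_pmf_single pmf_path_pmf simp del: upt_Suc)
qed auto

lemma nn_integral_step_pmf:
  assumes "w x \<in> {0..1}" "\<And>y. 0 \<le> f y"
  shows "(\<integral>\<^sup>+y. ennreal (f y) \<partial>step_pmf w x) = ennreal (w x * f (x + 1) + (1 - w x) * f (x - 1))"
proof -
  have "(\<integral>\<^sup>+y. ennreal (f y) \<partial>step_pmf w x) =
      ennreal (f (x + 1)) * ennreal (w x) + ennreal (f (x - 1)) * ennreal (1 - w x)"
    using assms by (simp add: step_pmf_def nn_integral_map_pmf)
  also have "\<dots> = ennreal (f (x + 1) * w x + f (x - 1) * (1 - w x))"
    using assms by (simp flip: ennreal_mult ennreal_plus)
  finally show ?thesis by (simp add: mult.commute)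
qed

lemma nn_integral_path_pmf:
  assumes w: "\<And>x. w x \<in> {0..1}" and f: "\<And>y. 0 \<le> f y"
  shows "(\<integral>\<^sup>+xs. ennreal (f (last xs)) \<partial>path_pmf w n) = ennreal (quenched_mean w n f)"
  using f
proof (induction n arbitrary: f)
  case (Suc n)
  have "(\<integral>\<^sup>+xs. ennreal (f (last xs)) \<partial>path_pmf w (Suc n)) =
      (\<integral>\<^sup>+xs. ennreal (w (last xs) * f (last xs + 1) + (1 - w (last xs)) * f (last xs - 1))
        \<partial>path_pmf w n)"
    using nn_integral_step_pmf[OF w Suc.prems] by (simp add: nn_integral_map_pmf)
  also have "\<dots> = ennreal (quenched_mean w n (\<lambda>x. w x * f (x + 1) + (1 - w x) * f (x - 1)))"
    by (rule Suc.IH) (use w Suc.prems in \<open>auto intro!: add_nonneg_nonneg mult_nonneg_nonneg\<close>)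
  finally show ?case by simp
qed simp

lemma nn_integral_quenched_law:
  assumes w: "\<And>x. w x \<in> {0..1}" and f: "\<And>y. 0 \<le> f y"
  shows "(\<integral>\<^sup>+z. ennreal (f (z n)) \<partial>quenched_law w) = ennreal (quenched_mean w n f)"
proof -
  have m: "(\<lambda>z. map z [0..<Suc n]) \<in> quenched_law w \<rightarrow>\<^sub>M count_space UNIV"
    using map_upt_measurable by (simp cong: measurable_cong_sets del: upt_Suc)
  have "(\<integral>\<^sup>+z. ennreal (f (z n)) \<partial>quenched_law w) =
      (\<integral>\<^sup>+xs. ennreal (f (last xs))
        \<partial>distr (quenched_law w) (count_space UNIV) (\<lambda>z. map z [0..<Suc n]))"
    by (subst nn_integral_distr[OF m]) auto
  then show ?thesis
    unfolding distr_quenched_law_path using nn_integral_path_pmf[of w f n] w f by simp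
qed

section \<open>The averaging operator, occupation sums and quenched martingales\<close>

lemma quenched_mean_linear:
  "quenched_mean w k (\<lambda>x. a * f x + b * g x) = a * quenched_mean w k f + b * quenched_mean w k g"
proof (induction k arbitrary: f g)
  case (Suc k)
  have "(\<lambda>x. w x * (a * f (x + 1) + b * g (x + 1)) + (1 - w x) * (a * f (x - 1) + b * g (x - 1))) =
     (\<lambda>x. a * (w x * f (x + 1) + (1 - w x) * f (x - 1)) + b * (w x * g (x + 1) + (1 - w x) * g (x - 1)))"
    by (simp add: fun_eq_iff algebra_simps)
  then show ?case by (simp only: quenched_mean.simps Suc.IH)
qed simp

lemma quenched_mean_mono:
  assumes w: "\<And>x. w x \<in> {0..1}" and "\<And>x. \<bar>x\<bar> \<le> int k \<Longrightarrow> f x \<le> g x"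
  shows "quenched_mean w k f \<le> quenched_mean w k g"
  using assms(2)
proof (induction k arbitrary: f g)
  case (Suc k)
  show ?case unfolding quenched_mean.simps
    by (rule Suc.IH)
      (use w in \<open>auto intro!: add_mono mult_left_mono Suc.prems simp: abs_le_iff\<close>)
qed simp

lemma quenched_mean_const: "quenched_mean w k (\<lambda>_. c) = c"
proof (induction k)
  case (Suc k)
  have "(\<lambda>x. w x * c + (1 - w x) * c) = (\<lambda>_. c)" by (simp add: algebra_simps)
  then show ?case using Suc by simp
qed simp

lemma quenched_mean_nonneg:
  assumes "\<And>x. w x \<in> {0..1}" and "\<And>x. \<bar>x\<bar> \<le> int k \<Longrightarrow> 0 \<le> f x"
  shows "0 \<le> quenched_mean w k f"
  using quenched_mean_mono[of w k "\<lambda>_. 0" f] assms by (simp add: quenched_mean_const)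

text \<open>Summation by parts. The occupation sum for \<open>f\<close> is \<open>f 0\<close> plus
  that of the one-step average of \<open>f\<close> over a shorter horizon; shifting the summation
  index moves the transition operator onto \<open>G\<close>, where the supersolution inequality
  applies. The window grows by one site per step, hence the horizon \<open>j\<close> inside the
  fixed \<open>n\<close>.\<close>

lemma sum_quenched_mean_le_green:
  fixes n :: nat
  assumes w: "\<And>x. w x \<in> {0..1}" and f: "\<And>x. 0 \<le> f x" and G0: "\<And>x. 0 \<le> G x"
    and G: "\<And>x. \<bar>x\<bar> \<le> int n \<Longrightarrow>
      of_bool (x = 0) + w (x - 1) * G (x - 1) + (1 - w (x + 1)) * G (x + 1) \<le> G x"
    and j: "j \<le> n"
  shows "(\<Sum>k\<le>j. quenched_mean w k f) \<le> (\<Sum>x\<in>{-int j..int j}. G x * f x)"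
  using f j
proof (induction j arbitrary: f)
  case 0
  have "1 \<le> G 0" using G[of 0] G0[of "-1"] G0[of 1] w[of "-1"] w[of 1]
    by (smt (verit) atLeastAtMost_iff mult_nonneg_nonneg of_bool_eq(2) add.left_neutral diff_0 abs_zero of_nat_0_le_iff)
  then show ?case using mult_right_mono[of 1 "G 0" "f 0"] 0 by simp
next
  case (Suc j)
  let ?P = "\<lambda>x. w x * f (x + 1) + (1 - w x) * f (x - 1)"
  let ?I = "{-int (Suc j)..int (Suc j)}"
  have P0: "0 \<le> ?P x" for x using w[of x] Suc.prems by auto
  have "(\<Sum>k\<le>Suc j. quenched_mean w k f) = f 0 + (\<Sum>k\<le>j. quenched_mean w k ?P)"
    by (subst sum.atMost_Suc_shift) simp
  also have "(\<Sum>k\<le>j. quenched_mean w k ?P) \<le> (\<Sum>x\<in>{-int j..int j}. G x * ?P x)"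
    using Suc.prems P0 by (intro Suc.IH) auto
  also have "\<dots> = (\<Sum>x\<in>{-int j..int j}. w x * G x * f (x + 1)) +
      (\<Sum>x\<in>{-int j..int j}. (1 - w x) * G x * f (x - 1))"
    by (simp add: algebra_simps flip: sum.distrib)
  also have "(\<Sum>x\<in>{-int j..int j}. w x * G x * f (x + 1)) =
      (\<Sum>x\<in>{-int j + 1..int j + 1}. w (x - 1) * G (x - 1) * f x)"
    by (rule sum.reindex_bij_witness[of _ "\<lambda>x. x - 1" "\<lambda>x. x + 1"]) auto
  also have "\<dots> \<le> (\<Sum>x\<in>?I. w (x - 1) * G (x - 1) * f x)"
    using w G0 Suc.prems by (intro sum_mono2) auto
  also have "(\<Sum>x\<in>{-int j..int j}. (1 - w x) * G x * f (x - 1)) =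
      (\<Sum>x\<in>{-int j - 1..int j - 1}. (1 - w (x + 1)) * G (x + 1) * f x)"
    by (rule sum.reindex_bij_witness[of _ "\<lambda>x. x + 1" "\<lambda>x. x - 1"]) auto
  also have "\<dots> \<le> (\<Sum>x\<in>?I. (1 - w (x + 1)) * G (x + 1) * f x)"
    using w G0 Suc.prems by (intro sum_mono2) auto
  also have "f 0 = (\<Sum>x\<in>?I. of_bool (x = 0) * f x)"
    by (subst sum.remove[of _ 0]) auto
  finally have "(\<Sum>k\<le>Suc j. quenched_mean w k f) \<le> (\<Sum>x\<in>?I. of_bool (x = 0) * f x) +
      ((\<Sum>x\<in>?I. w (x - 1) * G (x - 1) * f x) + (\<Sum>x\<in>?I. (1 - w (x + 1)) * G (x + 1) * f x))"
    by simp
  also have "\<dots> = (\<Sum>x\<in>?I. (of_bool (x = 0) + w (x - 1) * G (x - 1) + (1 - w (x + 1)) * G (x + 1)) * f x)"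
    by (simp only: distrib_right add.assoc sum.distrib)
  also have "\<dots> \<le> (\<Sum>x\<in>?I. G x * f x)"
    using Suc.prems by (intro sum_mono mult_right_mono G) auto
  finally show ?case .
qed

text \<open>The substitute for Burkholder's inequality. In \<open>abs_powr_add_le_linearised\<close>
  with N = n the linear term averages to zero over one step, and \<open>discrete_gronwall\<close>
  sums the rest. Harmonicity is asked for |x| < n, where the walk sits before each of its first n
  steps, so a coordinate that is harmonic only there qualifies.\<close>

lemma quenched_martingale_moment:
  fixes q :: real
  assumes q: "2 \<le> q"
  obtains C where "0 \<le> C" and "\<And>w S v n. (\<And>x. w x \<in> {0..1}) \<Longrightarrow> S 0 = 0 \<Longrightarrow>
    (\<And>x. \<bar>x\<bar> < int n \<Longrightarrow> w x * (S (x + 1) - S x - v) + (1 - w x) * (S (x - 1) - S x - v) = 0) \<Longrightarrow>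
    quenched_mean w n (\<lambda>x. \<bar>S x - v * n\<bar> powr q) \<le> C * n powr (q/2 - 1) * (\<Sum>k<n. quenched_mean w k
      (\<lambda>x. w x * \<bar>S (x + 1) - S x - v\<bar> powr q + (1 - w x) * \<bar>S (x - 1) - S x - v\<bar> powr q))"
proof -
  obtain C where C: "0 \<le> C" "\<And>a b N. 1 \<le> N \<Longrightarrow> \<bar>a + b\<bar> powr q \<le>
    \<bar>a\<bar> powr q + q * sgn a * \<bar>a\<bar> powr (q - 1) * b
      + C * (\<bar>a\<bar> powr q / N + N powr (q/2 - 1) * \<bar>b\<bar> powr q)"
    using abs_powr_add_le_linearised[OF q] by blast
  show thesis
  proof (rule that[of "exp C * C"])
    show "0 \<le> exp C * C" using C by simp
    fix w :: "int \<Rightarrow> real" and S :: "int \<Rightarrow> real" and v :: real and n :: nat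
    assume w: "\<And>x. w x \<in> {0..1}" and S0: "S 0 = 0"
      and mart: "\<And>x. \<bar>x\<bar> < int n \<Longrightarrow> w x * (S (x + 1) - S x - v) + (1 - w x) * (S (x - 1) - S x - v) = 0"
    define V where "V = (\<lambda>x. w x * \<bar>S (x + 1) - S x - v\<bar> powr q + (1 - w x) * \<bar>S (x - 1) - S x - v\<bar> powr q)"
    have V0: "0 \<le> V x" for x using w[of x] by (auto simp: V_def)
    define X where "X = (\<lambda>k. quenched_mean w k (\<lambda>x. \<bar>S x - v * real k\<bar> powr q))"
    define Y where "Y = (\<lambda>k. C * n powr (q/2 - 1) * quenched_mean w k V)"
    have "X n \<le> exp C * (\<Sum>k<n. Y k)"
    proof (rule discrete_gronwall[OF C(1)])
      show "0 \<le> Y k" for k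
        using C by (auto simp: Y_def intro!: mult_nonneg_nonneg quenched_mean_nonneg w V0)
      show "X 0 = 0" using q by (simp add: X_def S0)
      fix k assume k: "k < n"
      then have n1: "1 \<le> real n" by simp
      have "X (Suc k) \<le> quenched_mean w k (\<lambda>x. (1 + C / n) * \<bar>S x - v * real k\<bar> powr q
          + (C * n powr (q/2 - 1)) * V x)"
        unfolding X_def quenched_mean.simps
      proof (rule quenched_mean_mono[OF w])
        fix x :: int assume "\<bar>x\<bar> \<le> int k"
        with k have x: "\<bar>x\<bar> < int n" by simp
        define a where "a = S x - v * real k"
        define L where "L = q * sgn a * \<bar>a\<bar> powr (q - 1)"
        define b1 where "b1 = S (x + 1) - S x - v"
        define b2 where "b2 = S (x - 1) - S x - v"
        have e: "S (x + 1) - v * real (Suc k) = a + b1" "S (x - 1) - v * real (Suc k) = a + b2"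
          by (auto simp: a_def b1_def b2_def algebra_simps)
        have m: "w x * b1 + (1 - w x) * b2 = 0"
          using mart[OF x] by (simp add: b1_def b2_def)
        let ?R = "\<lambda>b. \<bar>a\<bar> powr q + L * b + C * (\<bar>a\<bar> powr q / n + n powr (q/2 - 1) * \<bar>b\<bar> powr q)"
        have "w x * \<bar>a + b1\<bar> powr q + (1 - w x) * \<bar>a + b2\<bar> powr q \<le> w x * ?R b1 + (1 - w x) * ?R b2"
          using w[of x] n1 unfolding L_def by (intro add_mono mult_left_mono C) auto
        also have "\<dots> = (1 + C / n) * \<bar>a\<bar> powr q + L * (w x * b1 + (1 - w x) * b2)
            + C * n powr (q/2 - 1) * (w x * \<bar>b1\<bar> powr q + (1 - w x) * \<bar>b2\<bar> powr q)"
          by (simp add: algebra_simps add_divide_distrib diff_divide_distrib)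
        finally show "w x * \<bar>S (x + 1) - v * real (Suc k)\<bar> powr q
            + (1 - w x) * \<bar>S (x - 1) - v * real (Suc k)\<bar> powr q
            \<le> (1 + C / n) * \<bar>S x - v * real k\<bar> powr q + C * n powr (q/2 - 1) * V x"
          unfolding e m V_def b1_def[symmetric] b2_def[symmetric] a_def[symmetric] by simp
      qed
      then show "X (Suc k) \<le> (1 + C / n) * X k + Y k"
        by (simp only: quenched_mean_linear X_def Y_def)
    qed
    then show "quenched_mean w n (\<lambda>x. \<bar>S x - v * n\<bar> powr q) \<le> exp C * C * n powr (q/2 - 1) *
      (\<Sum>k<n. quenched_mean w k
      (\<lambda>x. w x * \<bar>S (x + 1) - S x - v\<bar> powr q + (1 - w x) * \<bar>S (x - 1) - S x - v\<bar> powr q))"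
      by (simp add: X_def Y_def V_def sum_distrib_left mult.assoc)
  qed
qed

section \<open>Expectations over the environment\<close>

locale elliptic_environment =
  fixes \<alpha> :: "real measure" and c :: real
  assumes env: "env_distribution \<alpha>"
    and c_pos: "0 < c"
    and ell: "measure \<alpha> {c..1 - c} = 1"
begin

sublocale \<alpha>: prob_space \<alpha>
  using env by (simp add: env_distribution_def)

lemma sets_alpha [measurable_cong]: "sets \<alpha> = sets borel"
  using env by (simp add: env_distribution_def)

sublocale \<mu>: prob_space "env_law \<alpha>"
  using env by (rule prob_space_env_law)

lemma space_env_law [simp]: "space (env_law \<alpha>) = UNIV"
  using sets_eq_imp_space_eq[OF sets_alpha] by (simp add: env_law_def space_PiM)

lemma coordinate_measurable [measurable]: "(\<lambda>\<omega>. \<omega> x) \<in> borel_measurable (env_law \<alpha>)"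
proof -
  have "(\<lambda>\<omega>. \<omega> x) \<in> Pi\<^sub>M UNIV (\<lambda>_. \<alpha>) \<rightarrow>\<^sub>M \<alpha>" by simp
  then show ?thesis by (simp add: env_law_def sets_alpha cong: measurable_cong_sets)
qed

lemma c_le_half: "c \<le> 1/2"
proof (rule ccontr)
  assume "\<not> c \<le> 1/2"
  then have "{c..1 - c} = {}" by auto
  then show False using ell by simp
qed

text \<open>Clipping changes only a null set of environments, and makes every function of finitely many
  \<open>\<rho>(x)\<close> bounded everywhere.\<close>

definition clip :: "real \<Rightarrow> real" where
  "clip w = max c (min (1 - c) w)"

lemma clip_bounds: "c \<le> clip w" "clip w \<le> 1 - c" "0 < clip w" "clip w < 1"
  using c_le_half c_pos by (auto simp: clip_def)

lemma clip_measurable [measurable]: "clip \<in> borel_measurable borel"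
  unfolding clip_def by measurable

lemma AE_clip: "AE w in \<alpha>. clip w = w"
proof -
  have "AE w in \<alpha>. w \<in> {c..1 - c}"
    using \<alpha>.prob_eq_1[of "{c..1 - c}"] ell by (simp add: sets_alpha)
  then show ?thesis by eventually_elim (auto simp: clip_def)
qed

lemma AE_clip_env: "AE \<omega> in env_law \<alpha>. (\<lambda>x. clip (\<omega> x)) = \<omega>"
proof -
  have "AE \<omega> in env_law \<alpha>. clip (\<omega> x) = \<omega> x" for x
    unfolding env_law_def by (rule AE_PiM_component) (auto simp: AE_clip \<alpha>.prob_space_axioms)
  then have "AE \<omega> in env_law \<alpha>. \<forall>x. clip (\<omega> x) = \<omega> x"
    by (simp add: AE_all_countable)
  then show ?thesis by eventually_elim auto
qed

definition r :: "(int \<Rightarrow> real) \<Rightarrow> int \<Rightarrow> real" where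
  "r \<omega> x = rho (clip (\<omega> x))"

lemma rho_clip: "0 < rho (clip w)" "rho (clip w) \<le> 1 / c"
proof -
  show "0 < rho (clip w)" using clip_bounds[of w] by (simp add: rho_def)
  have "rho (clip w) \<le> 1 / clip w"
    using clip_bounds[of w] by (simp add: rho_def divide_right_mono)
  also have "\<dots> \<le> 1 / c" using clip_bounds[of w] c_pos by (simp add: frac_le)
  finally show "rho (clip w) \<le> 1 / c" .
qed

lemma rho_measurable [measurable]: "rho \<in> borel_measurable borel"
  unfolding rho_def[abs_def] by measurable

lemma r_bounds: "0 < r \<omega> x" "r \<omega> x \<le> 1 / c"
  using rho_clip by (auto simp: r_def)

lemma clip_r: "clip (\<omega> x) * (1 + r \<omega> x) = 1" "1 - clip (\<omega> x) = clip (\<omega> x) * r \<omega> x"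
  using clip_bounds[of "\<omega> x"] by (auto simp: r_def rho_def field_simps)

lemma r_upd [simp]: "y \<noteq> x \<Longrightarrow> r (fun_upd \<omega> x a) y = r \<omega> y"
  by (simp add: r_def)

definition m :: real where "m = (\<integral>w. rho w \<partial>\<alpha>)"

definition v :: real where "v = (1 - m) / (1 + m)"

lemma v_eq_speed: "v = speed \<alpha>"
  by (simp add: v_def m_def speed_def)

lemma integral_rho_clip_powr: "(\<integral>w. rho (clip w) powr q \<partial>\<alpha>) = (\<integral>w. rho w powr q \<partial>\<alpha>)"
  by (rule integral_cong_AE) (use AE_clip in \<open>auto simp: sets_alpha cong: measurable_cong_sets\<close>)

lemma integral_rho_clip: "(\<integral>w. rho (clip w) \<partial>\<alpha>) = m"
  unfolding m_def by (rule integral_cong_AE) (use AE_clip in \<open>auto simp: sets_alpha cong: measurable_cong_sets\<close>)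

text \<open>A class closed under the operations below, which settles integrability once and for all.
  The bound may depend on every parameter, such as the horizon of the walk; uniform estimates come
  from expectations.\<close>

definition bounded_meas :: "((int \<Rightarrow> real) \<Rightarrow> real) \<Rightarrow> bool" where
  "bounded_meas F \<longleftrightarrow> F \<in> borel_measurable (env_law \<alpha>) \<and> (\<exists>B. \<forall>\<omega>. \<bar>F \<omega>\<bar> \<le> B)"

lemma bounded_meas_measurable: "bounded_meas F \<Longrightarrow> F \<in> borel_measurable (env_law \<alpha>)"
  by (simp add: bounded_meas_def)

lemma bounded_meas_integrable: "bounded_meas F \<Longrightarrow> integrable (env_law \<alpha>) F"
proof -
  assume "bounded_meas F"
  then obtain B where "F \<in> borel_measurable (env_law \<alpha>)" "\<And>\<omega>. \<bar>F \<omega>\<bar> \<le> B"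
    by (auto simp: bounded_meas_def)
  then show ?thesis by (intro \<mu>.integrable_const_bound[of _ B]) auto
qed

lemma bounded_meas_const [intro!]: "bounded_meas (\<lambda>_. a)"
  by (auto simp: bounded_meas_def)

lemma bounded_meas_add [intro!]: "bounded_meas F \<Longrightarrow> bounded_meas G \<Longrightarrow> bounded_meas (\<lambda>\<omega>. F \<omega> + G \<omega>)"
  unfolding bounded_meas_def by (auto intro!: exI order_trans[OF abs_triangle_ineq] add_mono)

lemma bounded_meas_mult [intro!]: "bounded_meas F \<Longrightarrow> bounded_meas G \<Longrightarrow> bounded_meas (\<lambda>\<omega>. F \<omega> * G \<omega>)"
  unfolding bounded_meas_def abs_mult
proof safe
  fix B1 B2 assume "\<forall>\<omega>. \<bar>F \<omega>\<bar> \<le> B1" "\<forall>\<omega>. \<bar>G \<omega>\<bar> \<le> B2"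
  then show "\<exists>B. \<forall>\<omega>. \<bar>F \<omega>\<bar> * \<bar>G \<omega>\<bar> \<le> B"
    by (intro exI[of _ "B1 * B2"] allI mult_mono) (auto intro: order_trans[OF abs_ge_zero])
qed auto

lemma bounded_meas_uminus [intro!]: "bounded_meas F \<Longrightarrow> bounded_meas (\<lambda>\<omega>. - F \<omega>)"
  unfolding bounded_meas_def by auto

lemma bounded_meas_diff [intro!]: "bounded_meas F \<Longrightarrow> bounded_meas G \<Longrightarrow> bounded_meas (\<lambda>\<omega>. F \<omega> - G \<omega>)"
  using bounded_meas_add[of F "\<lambda>\<omega>. - G \<omega>"] by auto

lemma bounded_meas_abs [intro!]: "bounded_meas F \<Longrightarrow> bounded_meas (\<lambda>\<omega>. \<bar>F \<omega>\<bar>)"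
  unfolding bounded_meas_def by auto

lemma bounded_meas_sgn [intro!]: "bounded_meas F \<Longrightarrow> bounded_meas (\<lambda>\<omega>. sgn (F \<omega>))"
  unfolding bounded_meas_def by (auto intro!: exI[of _ 1] simp: sgn_if)

lemma bounded_meas_sum [intro!]: "(\<And>i. i \<in> I \<Longrightarrow> bounded_meas (F i)) \<Longrightarrow> bounded_meas (\<lambda>\<omega>. \<Sum>i\<in>I. F i \<omega>)"
  by (induction I rule: infinite_finite_induct) auto

lemma bounded_meas_max [intro!]: "bounded_meas F \<Longrightarrow> bounded_meas G \<Longrightarrow> bounded_meas (\<lambda>\<omega>. max (F \<omega>) (G \<omega>))"
proof -
  assume "bounded_meas F" "bounded_meas G"
  then have "bounded_meas (\<lambda>\<omega>. (F \<omega> + G \<omega> + \<bar>F \<omega> - G \<omega>\<bar>) * (1/2))" by (intro bounded_meas_mult bounded_meas_add bounded_meas_abs bounded_meas_diff bounded_meas_const)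
  moreover have "max x y = (x + y + \<bar>x - y\<bar>) * (1/2)" for x y :: real by (simp add: max_def)
  ultimately show ?thesis by presburger
qed

lemma bounded_meas_powr [intro]:
  assumes "bounded_meas F" "\<And>\<omega>. 0 \<le> F \<omega>" "0 \<le> q"
  shows "bounded_meas (\<lambda>\<omega>. F \<omega> powr q)"
proof -
  obtain B where B: "\<And>\<omega>. \<bar>F \<omega>\<bar> \<le> B" using assms(1) by (auto simp: bounded_meas_def)
  have "F \<omega> powr q \<le> B powr q" for \<omega>
    using assms(2,3) B[of \<omega>] by (intro powr_mono2) auto
  then show ?thesis using assms(1) by (auto simp: bounded_meas_def)
qed

lemma bounded_meas_abs_powr [intro]: "bounded_meas F \<Longrightarrow> 0 \<le> q \<Longrightarrow> bounded_meas (\<lambda>\<omega>. \<bar>F \<omega>\<bar> powr q)"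
  by (rule bounded_meas_powr) auto

lemma bounded_meas_r [intro!]: "bounded_meas (\<lambda>\<omega>. r \<omega> x)"
proof -
  have "(\<lambda>\<omega>. r \<omega> x) \<in> borel_measurable (env_law \<alpha>)" unfolding r_def by measurable
  moreover have "\<bar>r \<omega> x\<bar> \<le> 1 / c" for \<omega> using r_bounds[of \<omega> x] by simp
  ultimately show ?thesis unfolding bounded_meas_def by blast
qed

lemma expectation_mono: "bounded_meas F \<Longrightarrow> bounded_meas G \<Longrightarrow> (\<And>\<omega>. F \<omega> \<le> G \<omega>) \<Longrightarrow> \<mu>.expectation F \<le> \<mu>.expectation G"
  by (intro integral_mono bounded_meas_integrable)

lemma expectation_add: "bounded_meas F \<Longrightarrow> bounded_meas G \<Longrightarrow> \<mu>.expectation (\<lambda>\<omega>. F \<omega> + G \<omega>) = \<mu>.expectation F + \<mu>.expectation G"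
  by (intro Bochner_Integration.integral_add bounded_meas_integrable)

text \<open>Independence from the coordinate \<open>x\<close> is expressed as insensitivity to
  overwriting it. The product measure is the image of \<alpha> times the product over the other
  sites; there the integrand factorises and Fubini applies. The later factorisations of expectations
  rest on this lemma.\<close>

lemma expectation_coordinate_mult:
  assumes \<phi> [measurable]: "\<phi> \<in> borel_measurable borel" and \<phi>_bd: "\<And>w. \<bar>\<phi> w\<bar> \<le> B"
    and F: "bounded_meas F" and upd: "\<And>\<omega> a. F (fun_upd \<omega> x a) = F \<omega>"
  shows "\<mu>.expectation (\<lambda>\<omega>. \<phi> (\<omega> x) * F \<omega>) = (\<integral>w. \<phi> w \<partial>\<alpha>) * \<mu>.expectation F"
proof -
  let ?Q = "Pi\<^sub>M (UNIV - {x}) (\<lambda>_. \<alpha>)"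
  let ?u = "\<lambda>(a, X). fun_upd X x a"
  interpret Q: prob_space ?Q by (intro prob_space_PiM \<alpha>.prob_space_axioms)
  interpret pair_prob_space \<alpha> ?Q ..
  have ins: "insert x (UNIV - {x}) = UNIV" by auto
  have P_eq: "distr (\<alpha> \<Otimes>\<^sub>M ?Q) (env_law \<alpha>) ?u = env_law \<alpha>"
    using distr_pair_PiM_eq_PiM[of "UNIV - {x}" "\<lambda>_. \<alpha>" x] \<alpha>.prob_space_axioms
    by (simp add: ins env_law_def)
  have u: "?u \<in> \<alpha> \<Otimes>\<^sub>M ?Q \<rightarrow>\<^sub>M env_law \<alpha>"
  proof -
    have "(\<lambda>p. fun_upd (snd p) x (fst p)) \<in> \<alpha> \<Otimes>\<^sub>M ?Q \<rightarrow>\<^sub>M Pi\<^sub>M (insert x (UNIV - {x})) (\<lambda>_. \<alpha>)"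
      by (rule measurable_fun_upd[where J = "UNIV - {x}"]) auto
    then show ?thesis by (simp add: ins env_law_def case_prod_unfold)
  qed
  obtain D where D: "\<And>\<omega>. \<bar>F \<omega>\<bar> \<le> D" using F by (auto simp: bounded_meas_def)
  have Fm [measurable]: "F \<in> borel_measurable (env_law \<alpha>)" using F by (rule bounded_meas_measurable)
  have FQ: "F \<in> borel_measurable ?Q"
  proof -
    \<comment> \<open>\<open>F\<close> is measurable on the full product. Inserting the dummy value
      0 at \<open>x\<close> maps the smaller product into it, and by \<open>upd\<close> this leaves
      \<open>F\<close> unchanged.\<close>
    have "(\<lambda>X. fun_upd X x 0) \<in> ?Q \<rightarrow>\<^sub>M env_law \<alpha>"
    proof -
      have "(\<lambda>X. fun_upd X x 0) \<in> ?Q \<rightarrow>\<^sub>M Pi\<^sub>M (insert x (UNIV - {x})) (\<lambda>_. \<alpha>)"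
        by (rule measurable_fun_upd[where J = "UNIV - {x}"])
          (auto simp: sets_eq_imp_space_eq[OF sets_alpha])
      then show ?thesis by (simp add: ins env_law_def)
    qed
    from measurable_compose[OF this Fm] show ?thesis by (simp add: upd)
  qed
  have *: "\<mu>.expectation (\<lambda>\<omega>. \<psi> (\<omega> x) * F \<omega>) = (\<integral>w. \<psi> w \<partial>\<alpha>) * (\<integral>X. F X \<partial>?Q)"
    if [measurable]: "\<psi> \<in> borel_measurable borel" and \<psi>_bd: "\<And>w. \<bar>\<psi> w\<bar> \<le> B'" for \<psi> B'
  proof -
    have "\<mu>.expectation (\<lambda>\<omega>. \<psi> (\<omega> x) * F \<omega>) =
        (\<integral>\<omega>. \<psi> (\<omega> x) * F \<omega> \<partial>distr (\<alpha> \<Otimes>\<^sub>M ?Q) (env_law \<alpha>) ?u)"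
      by (simp add: P_eq)
    also have "\<dots> = (\<integral>p. \<psi> ((?u p) x) * F (?u p) \<partial>(\<alpha> \<Otimes>\<^sub>M ?Q))"
      by (rule integral_distr[OF u]) measurable
    also have "\<dots> = (\<integral>p. \<psi> (fst p) * F (snd p) \<partial>(\<alpha> \<Otimes>\<^sub>M ?Q))"
      by (simp add: case_prod_unfold upd)
    also have "\<dots> = (\<integral>a. \<integral>X. \<psi> (fst (a, X)) * F (snd (a, X)) \<partial>?Q \<partial>\<alpha>)"
    proof (rule integral_fst'[symmetric], rule integrable_const_bound[where B = "B' * D"])
      show "AE p in \<alpha> \<Otimes>\<^sub>M ?Q. norm (\<psi> (fst p) * F (snd p)) \<le> B' * D"
        using \<psi>_bd D by (auto simp: abs_mult intro!: AE_I2 mult_mono intro: order_trans[OF abs_ge_zero])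
      have [measurable]: "F \<in> borel_measurable ?Q" by (rule FQ)
      show "(\<lambda>p. \<psi> (fst p) * F (snd p)) \<in> borel_measurable (\<alpha> \<Otimes>\<^sub>M ?Q)"
        by measurable
    qed
    finally show ?thesis by simp
  qed
  \<comment> \<open>The constant function 1 identifies the integral of \<open>F\<close> over the
    other sites with its full expectation.\<close>
  from *[of "\<lambda>_. 1" 1] have "\<mu>.expectation F = (\<integral>X. F X \<partial>?Q)" by (simp add: \<alpha>.prob_space)
  with *[OF \<phi> \<phi>_bd] show ?thesis by simp
qed

lemma expectation_r_powr_mult:
  assumes "bounded_meas F" "\<And>\<omega> a. F (fun_upd \<omega> x a) = F \<omega>" "0 \<le> q"
  shows "\<mu>.expectation (\<lambda>\<omega>. r \<omega> x powr q * F \<omega>) = (\<integral>w. rho w powr q \<partial>\<alpha>) * \<mu>.expectation F"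
proof -
  have "\<bar>rho (clip w) powr q\<bar> \<le> (1 / c) powr q" for w
    using rho_clip[of w] assms(3) by (simp add: powr_mono2)
  from expectation_coordinate_mult[of "\<lambda>w. rho (clip w) powr q" "(1 / c) powr q" F x, OF _ this assms(1,2)] show ?thesis
    by (simp add: r_def integral_rho_clip_powr)
qed

lemma expectation_r_mult:
  assumes "bounded_meas F" "\<And>\<omega> a. F (fun_upd \<omega> x a) = F \<omega>"
  shows "\<mu>.expectation (\<lambda>\<omega>. r \<omega> x * F \<omega>) = m * \<mu>.expectation F"
  using expectation_coordinate_mult[of "\<lambda>w. rho (clip w)" "1/c" F x] rho_clip assms
  by (simp add: r_def integral_rho_clip less_imp_le)

lemma expectation_centred_r_mult:
  assumes "bounded_meas F" "\<And>\<omega> a. F (fun_upd \<omega> x a) = F \<omega>"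
  shows "\<mu>.expectation (\<lambda>\<omega>. (r \<omega> x - m) * F \<omega>) = 0"
proof -
  have "\<mu>.expectation (\<lambda>\<omega>. (r \<omega> x - m) * F \<omega>) =
      \<mu>.expectation (\<lambda>\<omega>. r \<omega> x * F \<omega>) - \<mu>.expectation (\<lambda>\<omega>. m * F \<omega>)"
    unfolding left_diff_distrib
    using assms(1) by (intro Bochner_Integration.integral_diff bounded_meas_integrable) auto
  then show ?thesis using expectation_r_mult[OF assms] by simp
qed

lemma m_pos: "0 < m"
proof -
  have "integrable \<alpha> (\<lambda>w. rho (clip w))"
    by (rule \<alpha>.integrable_const_bound[of _ "1/c"])
      (use rho_clip in \<open>auto simp: less_imp_le sets_alpha intro!: AE_I2 cong: measurable_cong_sets\<close>)
  then have "0 < (\<integral>w. rho (clip w) \<partial>\<alpha>)"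
    using \<alpha>.integral_less_AE_space[of "\<lambda>_. 0" "\<lambda>w. rho (clip w)"] rho_clip
    by (simp add: \<alpha>.emeasure_space_1)
  then show ?thesis by (simp add: integral_rho_clip)
qed

end

section \<open>Moments of the corrector and of Green's function\<close>

locale subunit_moment_environment = elliptic_environment +
  fixes q :: real
  assumes q: "2 \<le> q" and m_less: "m < 1" and rho_moment: "(\<integral>w. rho w powr q \<partial>\<alpha>) < 1"
begin

lemma prob_UNIV [simp]: "measure (env_law \<alpha>) UNIV = 1"
  using \<mu>.prob_space by simp

lemma v_pos: "0 < v"
  using m_pos m_less by (simp add: v_def)

lemma v_le: "v \<le> 1"
  using m_pos by (simp add: v_def)

text \<open>The increment \<open>\<Delta>(L + j)\<close> of the harmonic coordinate. Starting the recursion at \<open>L\<close>, beyond the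
  reach of the walk, with the stationary mean \<open>1\<close> avoids the infinite past.\<close>

primrec D :: "int \<Rightarrow> (int \<Rightarrow> real) \<Rightarrow> nat \<Rightarrow> real" where
  "D L \<omega> 0 = 1"
| "D L \<omega> (Suc j) = v * (1 + r \<omega> (L + int j)) + r \<omega> (L + int j) * D L \<omega> j"

lemma D_pos: "0 < D L \<omega> j"
  by (induction j) (use v_pos r_bounds in \<open>auto intro!: add_pos_pos mult_pos_pos\<close>)

lemma bounded_meas_D [intro!]: "bounded_meas (\<lambda>\<omega>. D L \<omega> j)"
  by (induction j) auto

lemma D_upd: "L + int j \<le> x \<Longrightarrow> D L (fun_upd \<omega> x a) j = D L \<omega> j"
  by (induction j) auto

lemma bounded_meas_D_powr [intro]: "bounded_meas (\<lambda>\<omega>. D L \<omega> j powr q)"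
  using q D_pos by (intro bounded_meas_powr) (auto simp: less_imp_le)

text \<open>A random affine recursion: the multiplier \<open>r\<close> at the new site is
  independent of \<open>D L \<omega> j\<close> and has q-th moment \<kappa> < 1, while the
  inhomogeneity is bounded by ellipticity. For small \<epsilon>, \<open>powr_add_le_weighted\<close>
  leaves the contraction factor \<theta> = (1 + \<epsilon>) \<kappa> < 1.\<close>

lemma D_moment:
  obtains C where "0 \<le> C" and "\<And>L j. \<mu>.expectation (\<lambda>\<omega>. D L \<omega> j powr q) \<le> C"
proof -
  define \<kappa> where "\<kappa> = (\<integral>w. rho w powr q \<partial>\<alpha>)"
  have \<kappa>: "0 \<le> \<kappa>" "\<kappa> < 1" using rho_moment by (auto simp: \<kappa>_def)
  define \<epsilon> where "\<epsilon> = (1 - \<kappa>) / 2"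
  define \<theta> where "\<theta> = (1 + \<epsilon>) * \<kappa>"
  have \<epsilon>: "\<epsilon> > 0" using \<kappa> by (simp add: \<epsilon>_def)
  have "\<theta> = \<kappa> + \<epsilon> * \<kappa>" by (simp add: \<theta>_def algebra_simps)
  also have "\<dots> \<le> \<kappa> + \<epsilon> * 1" using \<kappa> \<epsilon> by (intro add_mono mult_left_mono) auto
  also have "\<dots> < 1" using \<kappa> by (simp add: \<epsilon>_def field_simps)
  finally have \<theta>: "0 \<le> \<theta>" "\<theta> < 1" using \<kappa> \<epsilon> by (auto simp: \<theta>_def)
  obtain K where K: "0 \<le> K"
    "\<And>a b. 0 \<le> a \<Longrightarrow> 0 \<le> b \<Longrightarrow> (a + b) powr q \<le> (1 + \<epsilon>) * a powr q + K * b powr q"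
    using powr_add_le_weighted[of q \<epsilon>] q \<epsilon> by auto
  define B where "B = K * (1 + 1 / c) powr q"
  have B: "0 \<le> B" using K by (simp add: B_def)
  \<comment> \<open>An invariant level of the recursion: \<theta> C + B <= C, and the summand 1
    accommodates the initial value \<open>D L \<omega> 0 = 1\<close>.\<close>
  define C where "C = 1 + B / (1 - \<theta>)"
  have "\<mu>.expectation (\<lambda>\<omega>. D L \<omega> j powr q) \<le> C" for L j
  proof (induction j)
    case 0
    then show ?case using B \<theta> by (simp add: C_def \<mu>.prob_space)
  next
    case (Suc j)
    let ?x = "L + int j"
    have "D L \<omega> (Suc j) powr q \<le> (1 + \<epsilon>) * (r \<omega> ?x powr q * D L \<omega> j powr q) + B" for \<omega>
    proof -
      have "D L \<omega> (Suc j) powr q = (r \<omega> ?x * D L \<omega> j + v * (1 + r \<omega> ?x)) powr q"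
        by (simp add: add.commute)
      also have "\<dots> \<le> (1 + \<epsilon>) * (r \<omega> ?x * D L \<omega> j) powr q + K * (v * (1 + r \<omega> ?x)) powr q"
        using v_pos D_pos[of L \<omega> j] r_bounds[of \<omega> ?x] by (intro K) (auto simp: less_imp_le)
      also have "(v * (1 + r \<omega> ?x)) powr q \<le> (1 * (1 + 1 / c)) powr q"
        using v_pos v_le r_bounds[of \<omega> ?x] q by (intro powr_mono2 mult_mono) auto
      finally show ?thesis
        using D_pos[of L \<omega> j] r_bounds[of \<omega> ?x] K by (simp add: B_def powr_mult mult_left_mono)
    qed
    moreover have b: "bounded_meas (\<lambda>\<omega>. r \<omega> ?x powr q * D L \<omega> j powr q)"
      using q r_bounds by (intro bounded_meas_mult bounded_meas_D_powr bounded_meas_powr) (auto simp: less_imp_le)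
    ultimately have "\<mu>.expectation (\<lambda>\<omega>. D L \<omega> (Suc j) powr q)
        \<le> \<mu>.expectation (\<lambda>\<omega>. (1 + \<epsilon>) * (r \<omega> ?x powr q * D L \<omega> j powr q) + B)"
      by (intro expectation_mono bounded_meas_D_powr bounded_meas_add bounded_meas_mult[OF bounded_meas_const b] bounded_meas_const)
    also have "\<dots> = (1 + \<epsilon>) * \<mu>.expectation (\<lambda>\<omega>. r \<omega> ?x powr q * D L \<omega> j powr q) + B"
      by (subst expectation_add[OF bounded_meas_mult[OF bounded_meas_const b] bounded_meas_const]) (simp add: \<mu>.prob_space)
    also have "\<mu>.expectation (\<lambda>\<omega>. r \<omega> ?x powr q * D L \<omega> j powr q) =
        \<kappa> * \<mu>.expectation (\<lambda>\<omega>. D L \<omega> j powr q)"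
      unfolding \<kappa>_def using q by (intro expectation_r_powr_mult bounded_meas_D_powr) (simp_all add: D_upd)
    also have "(1 + \<epsilon>) * (\<kappa> * \<mu>.expectation (\<lambda>\<omega>. D L \<omega> j powr q)) \<le> (1 + \<epsilon>) * (\<kappa> * C)"
      using \<kappa> \<epsilon> by (intro mult_left_mono Suc.IH) auto
    also have "(1 + \<epsilon>) * (\<kappa> * C) + B = \<theta> * C + B" by (simp add: \<theta>_def)
    also have "\<dots> \<le> C"
    proof -
      have "(1 - \<theta>) * C = (1 - \<theta>) + B" using \<theta> by (simp add: C_def field_simps)
      then show ?thesis using \<theta> by (simp add: algebra_simps)
    qed
    finally show ?case by simp
  qed
  moreover have "0 \<le> C" using B \<theta> by (simp add: C_def)
  ultimately show thesis using that by blast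
qed

text \<open>\<open>U N \<omega> j\<close> is \<open>\<omega>(x) G(0, x)\<close> at \<open>x = N - j\<close> for the Green function \<open>G\<close> of the walk killed at \<open>N\<close>;
  the recursion says that the net flux from \<open>x\<close> to \<open>x + 1\<close> is \<open>1\<close> for \<open>0 \<le> x\<close> and \<open>0\<close> otherwise.\<close>

primrec U :: "int \<Rightarrow> (int \<Rightarrow> real) \<Rightarrow> nat \<Rightarrow> real" where
  "U N \<omega> 0 = 0"
| "U N \<omega> (Suc j) = of_bool (int j < N) + r \<omega> (N - int j) * U N \<omega> j"

lemma U_nonneg: "0 \<le> U N \<omega> j"
  by (induction j) (use r_bounds in \<open>auto intro!: add_nonneg_nonneg mult_nonneg_nonneg simp: less_imp_le\<close>)

lemma bounded_meas_U [intro!]: "bounded_meas (\<lambda>\<omega>. U N \<omega> j)"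
  by (induction j) auto

lemma U_upd: "x \<le> N - int j \<Longrightarrow> U N (fun_upd \<omega> x a) j = U N \<omega> j"
  by (induction j) auto

text \<open>Each step of the recursion exposes the fresh coordinate N - j, on which neither
  \<open>F\<close> nor the previous \<open>U\<close> depends, so it contributes a factor
  \<open>m\<close>; the geometric series sums to 1/(1 - m). The condition on \<open>F\<close>
  weakens as \<open>j\<close> decreases, so the induction hypothesis applies to the same
  \<open>F\<close>.\<close>

lemma expectation_U_mult_le:
  assumes F: "bounded_meas F" "\<And>\<omega>. 0 \<le> F \<omega>" and upd: "\<And>\<omega> x a. N - int j < x \<Longrightarrow> F (fun_upd \<omega> x a) = F \<omega>"
  shows "\<mu>.expectation (\<lambda>\<omega>. U N \<omega> j * F \<omega>) \<le> \<mu>.expectation F / (1 - m)"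
  using upd
proof (induction j)
  case 0
  have "0 \<le> \<mu>.expectation F" using F by (intro integral_nonneg_AE) auto
  then show ?case using m_less by simp
next
  case (Suc j)
  let ?x = "N - int j"
  have b: "bounded_meas (\<lambda>\<omega>. r \<omega> ?x * (U N \<omega> j * F \<omega>))" using F by auto
  have "U N \<omega> (Suc j) * F \<omega> \<le> F \<omega> + r \<omega> ?x * (U N \<omega> j * F \<omega>)" for \<omega>
    using F(2)[of \<omega>] by (simp add: distrib_right of_bool_def)
  then have "\<mu>.expectation (\<lambda>\<omega>. U N \<omega> (Suc j) * F \<omega>)
      \<le> \<mu>.expectation (\<lambda>\<omega>. F \<omega> + r \<omega> ?x * (U N \<omega> j * F \<omega>))"
    by (intro expectation_mono bounded_meas_mult bounded_meas_U bounded_meas_add b F)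
  also have "\<dots> = \<mu>.expectation F + \<mu>.expectation (\<lambda>\<omega>. r \<omega> ?x * (U N \<omega> j * F \<omega>))"
    by (intro expectation_add b F)
  also have "\<mu>.expectation (\<lambda>\<omega>. r \<omega> ?x * (U N \<omega> j * F \<omega>)) = m * \<mu>.expectation (\<lambda>\<omega>. U N \<omega> j * F \<omega>)"
  proof (intro expectation_r_mult bounded_meas_mult bounded_meas_U F)
    fix \<omega> a
    have "F (fun_upd \<omega> ?x a) = F \<omega>" by (rule Suc.prems) simp
    then show "U N (fun_upd \<omega> ?x a) j * F (fun_upd \<omega> ?x a) = U N \<omega> j * F \<omega>"
      by (simp only: U_upd[OF order_refl])
  qed
  also have "\<dots> \<le> m * (\<mu>.expectation F / (1 - m))"
    using m_pos Suc.prems by (intro mult_left_mono Suc.IH) auto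
  also have "\<mu>.expectation F + m * (\<mu>.expectation F / (1 - m)) = \<mu>.expectation F / (1 - m)"
    using m_less by (simp add: field_simps)
  finally show ?case by simp
qed

text \<open>\<open>A\<close> is the corrector \<open>h\<close> and \<open>N\<close> the martingale part of \<open>(1 - m) A\<close>, both counted from \<open>L\<close>.\<close>

definition N :: "int \<Rightarrow> (int \<Rightarrow> real) \<Rightarrow> nat \<Rightarrow> real" where
  "N L \<omega> i = (\<Sum>j<i. (r \<omega> (L + int j) - m) * (v + D L \<omega> j))"

definition A :: "int \<Rightarrow> (int \<Rightarrow> real) \<Rightarrow> nat \<Rightarrow> real" where
  "A L \<omega> i = (\<Sum>j<i. D L \<omega> (Suc j) - 1)"

text \<open>Because v (1 + m) = 1 - m, consecutive increments D and D' satisfy D' - 1 = m (D - 1) +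
  (r - m)(v + D). In the sum, the first part reproduces m times \<open>A\<close> up to a boundary
  term and the second is \<open>N\<close>.\<close>

lemma A_N: "(1 - m) * A L \<omega> i = N L \<omega> i - m * (D L \<omega> i - 1)"
proof (induction i)
  case (Suc i)
  have v: "v * (1 + m) = 1 - m" using m_pos by (simp add: v_def)
  have "(1 - m) * A L \<omega> (Suc i) = (1 - m) * A L \<omega> i + (D L \<omega> (Suc i) - 1) - m * (D L \<omega> (Suc i) - 1)"
    by (simp add: A_def algebra_simps)
  moreover have "D L \<omega> (Suc i) - 1 = m * (D L \<omega> i - 1) + (r \<omega> (L + int i) - m) * (v + D L \<omega> i)"
  proof -
    have "m * (D L \<omega> i - 1) + (r \<omega> (L + int i) - m) * (v + D L \<omega> i) =
      r \<omega> (L + int i) * (v + D L \<omega> i) - (m + v * m)" by (simp add: algebra_simps)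
    moreover have "m + v * m = 1 - v" using v by (simp add: algebra_simps)
    ultimately show ?thesis by (simp add: algebra_simps)
  qed
  moreover have "N L \<omega> (Suc i) = N L \<omega> i + (r \<omega> (L + int i) - m) * (v + D L \<omega> i)"
    by (simp add: N_def)
  ultimately show ?case using Suc.IH by linarith
qed (simp add: A_def N_def)

lemma bounded_meas_N [intro!]: "bounded_meas (\<lambda>\<omega>. N L \<omega> i)"
  unfolding N_def by auto

lemma N_upd: "L + int i \<le> x \<Longrightarrow> N L (fun_upd \<omega> x a) i = N L \<omega> i"
  unfolding N_def by (intro sum.cong) (auto simp: D_upd)

lemma N_0 [simp]: "N L \<omega> 0 = 0"
  by (simp add: N_def)

lemma N_Suc: "N L \<omega> (Suc i) = N L \<omega> i + (r \<omega> (L + int i) - m) * (v + D L \<omega> i)"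
  by (simp add: N_def)

section \<open>Running maximum and moments of the environment martingale\<close>

primrec maxN :: "int \<Rightarrow> (int \<Rightarrow> real) \<Rightarrow> nat \<Rightarrow> real" where
  "maxN L \<omega> 0 = 0"
| "maxN L \<omega> (Suc i) = max (maxN L \<omega> i) \<bar>N L \<omega> (Suc i)\<bar>"

lemma maxN_nonneg: "0 \<le> maxN L \<omega> i"
  by (induction i) auto

lemma bounded_meas_maxN [intro!]: "bounded_meas (\<lambda>\<omega>. maxN L \<omega> i)"
  by (induction i) auto

lemma maxN_upd: "L + int i \<le> x \<Longrightarrow> maxN L (fun_upd \<omega> x a) i = maxN L \<omega> i"
  by (induction i) (auto simp: N_upd)

lemma N_le_maxN: "j \<le> i \<Longrightarrow> \<bar>N L \<omega> j\<bar> \<le> maxN L \<omega> i"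
proof (induction i)
  case (Suc i)
  then show ?case by (cases "j = Suc i") (auto simp: le_max_iff_disj)
qed simp

text \<open>The scheme of \<open>quenched_martingale_moment\<close> with space in place of time: as
  sites are revealed from left to right, r - m at the new site is centred and independent of
  \<open>N L \<omega> k\<close> and \<open>D L \<omega> k\<close>, so the linear term vanishes.
  \<open>D_moment\<close> bounds the increments.\<close>

lemma N_moment:
  obtains C where "0 \<le> C" and "\<And>L i. 1 \<le> i \<Longrightarrow> \<mu>.expectation (\<lambda>\<omega>. \<bar>N L \<omega> i\<bar> powr q) \<le> C * i powr (q/2)"
proof -
  obtain K where K: "0 \<le> K" "\<And>a b N. 1 \<le> N \<Longrightarrow> \<bar>a + b\<bar> powr q \<le>
    \<bar>a\<bar> powr q + q * sgn a * \<bar>a\<bar> powr (q - 1) * b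
      + K * (\<bar>a\<bar> powr q / N + N powr (q/2 - 1) * \<bar>b\<bar> powr q)"
    using abs_powr_add_le_linearised[OF q] by blast
  obtain CD where CD: "0 \<le> CD" "\<And>L j. \<mu>.expectation (\<lambda>\<omega>. D L \<omega> j powr q) \<le> CD"
    using D_moment by blast
  define d where "d = (\<lambda>L \<omega> j. (r \<omega> (L + int j) - m) * (v + D L \<omega> j))"
  have bounded_meas_d [intro!]: "bounded_meas (\<lambda>\<omega>. d L \<omega> j)" for L j unfolding d_def by auto
  have q0: "0 \<le> q" "0 \<le> q - 1" using q by auto
  define B where "B = (1 / c + 1) powr q * (2 powr q * (1 + CD))"
  have B0: "0 \<le> B" using CD by (simp add: B_def)
  have d_moment: "\<mu>.expectation (\<lambda>\<omega>. \<bar>d L \<omega> j\<bar> powr q) \<le> B" for L j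
  proof -
    have "\<bar>d L \<omega> j\<bar> powr q \<le> (1 / c + 1) powr q * (2 powr q * (1 + D L \<omega> j powr q))" for \<omega>
    proof -
      have "\<bar>r \<omega> (L + int j) - m\<bar> \<le> 1 / c + 1"
        using r_bounds[of \<omega> "L + int j"] m_pos m_less by linarith
      then have "\<bar>d L \<omega> j\<bar> powr q \<le> ((1 / c + 1) * (1 + D L \<omega> j)) powr q"
        using v_pos v_le D_pos[of L \<omega> j] q0 unfolding d_def abs_mult
        by (intro powr_mono2 mult_mono) auto
      also have "\<dots> = (1 / c + 1) powr q * (1 + D L \<omega> j) powr q"
        using c_pos D_pos[of L \<omega> j] by (simp add: powr_mult)
      also have "\<dots> \<le> (1 / c + 1) powr q * (2 powr q * (1 + D L \<omega> j powr q))"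
        using powr_add_le[of q 1 "D L \<omega> j"] q0 D_pos[of L \<omega> j] by (intro mult_left_mono) auto
      finally show ?thesis .
    qed
    then have "\<mu>.expectation (\<lambda>\<omega>. \<bar>d L \<omega> j\<bar> powr q)
        \<le> \<mu>.expectation (\<lambda>\<omega>. (1 / c + 1) powr q * (2 powr q * (1 + D L \<omega> j powr q)))"
      by (intro expectation_mono bounded_meas_abs_powr bounded_meas_mult bounded_meas_const bounded_meas_add bounded_meas_D_powr bounded_meas_d q0)
    also have "\<dots> = (1 / c + 1) powr q * (2 powr q * (1 + \<mu>.expectation (\<lambda>\<omega>. D L \<omega> j powr q)))"
      by (simp add: expectation_add[OF bounded_meas_const bounded_meas_D_powr] \<mu>.prob_space)
    also have "\<dots> \<le> B" unfolding B_def by (intro mult_left_mono add_mono CD) auto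
    finally show ?thesis .
  qed
  show thesis
  proof (rule that[of "exp K * K * B"])
    show "0 \<le> exp K * K * B" using K B0 by simp
    fix L :: int and i :: nat assume i: "1 \<le> i"
    then have i1: "1 \<le> real i" by simp
    have "\<mu>.expectation (\<lambda>\<omega>. \<bar>N L \<omega> i\<bar> powr q) \<le> exp K * (\<Sum>k<i. K * i powr (q/2 - 1) * B)"
    proof (rule discrete_gronwall[OF K(1)])
      show "0 \<le> K * i powr (q/2 - 1) * B" using K B0 by simp
      show "\<mu>.expectation (\<lambda>\<omega>. \<bar>N L \<omega> 0\<bar> powr q) = 0" using q by simp
      fix k assume "k < i"
      let ?Z = "\<lambda>\<omega>. (r \<omega> (L + int k) - m) * (q * sgn (N L \<omega> k) * \<bar>N L \<omega> k\<bar> powr (q - 1) * (v + D L \<omega> k))"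
      let ?X = "\<lambda>\<omega>. (1 + K / i) * \<bar>N L \<omega> k\<bar> powr q"
      let ?Y = "\<lambda>\<omega>. (K * i powr (q/2 - 1)) * \<bar>d L \<omega> k\<bar> powr q"
      have bs: "bounded_meas ?Z" "bounded_meas ?X" "bounded_meas ?Y" using q0 by auto
      have "\<bar>N L \<omega> (Suc k)\<bar> powr q \<le> ?Z \<omega> + (?X \<omega> + ?Y \<omega>)" for \<omega>
        using K(2)[OF i1, of "N L \<omega> k" "d L \<omega> k"] by (simp add: N_Suc d_def algebra_simps)
      then have "\<mu>.expectation (\<lambda>\<omega>. \<bar>N L \<omega> (Suc k)\<bar> powr q) \<le> \<mu>.expectation (\<lambda>\<omega>. ?Z \<omega> + (?X \<omega> + ?Y \<omega>))"
        using bs q0 by (intro expectation_mono) auto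
      also have "\<dots> = \<mu>.expectation ?Z + (\<mu>.expectation ?X + \<mu>.expectation ?Y)"
        using bs by (simp add: expectation_add bounded_meas_add)
      also have "\<mu>.expectation ?Z = 0"
        using q0 by (intro expectation_centred_r_mult) (auto simp: N_upd D_upd)
      also have "\<mu>.expectation ?Y \<le> K * i powr (q/2 - 1) * B"
        using d_moment[of L k] K by (simp add: mult_left_mono)
      finally show "\<mu>.expectation (\<lambda>\<omega>. \<bar>N L \<omega> (Suc k)\<bar> powr q)
          \<le> (1 + K / i) * \<mu>.expectation (\<lambda>\<omega>. \<bar>N L \<omega> k\<bar> powr q) + K * i powr (q/2 - 1) * B"
        by simp
    qed
    also have "\<dots> = exp K * K * B * (i powr 1 * i powr (q/2 - 1))" by simp
    also have "i powr 1 * i powr (q/2 - 1) = i powr (q/2)" by (simp only: flip: powr_add) simp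
    finally show "\<mu>.expectation (\<lambda>\<omega>. \<bar>N L \<omega> i\<bar> powr q) \<le> exp K * K * B * i powr (q/2)" .
  qed
qed

lemma maxN_moment_le:
  obtains C where "0 \<le> C" and "\<And>L i. \<mu>.expectation (\<lambda>\<omega>. maxN L \<omega> i powr q)
    \<le> C * \<mu>.expectation (\<lambda>\<omega>. \<bar>N L \<omega> i\<bar> powr q)"
proof -
  \<comment> \<open>Chosen so that the Young inequality below uses up half of the coefficient q - 1
    of maxN^q in \<open>T\<close>; the other half is left to be estimated.\<close>
  define \<epsilon> where "\<epsilon> = (q - 1) / (2 * q)"
  have \<epsilon>: "0 < \<epsilon>" "q * \<epsilon> = (q - 1) / 2" using q by (auto simp: \<epsilon>_def)
  have q0: "0 \<le> q" "0 \<le> q - 1" using q by auto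
  define C where "C = q * (1/\<epsilon>) powr (q - 1) / ((q - 1) / 2)"
  have young: "a powr (q - 1) * b \<le> \<epsilon> * a powr q + (1/\<epsilon>) powr (q - 1) * b powr q"
    if ab: "0 \<le> a" "0 \<le> b" for a b
  proof (cases "b \<le> \<epsilon> * a")
    case True
    then have "a powr (q - 1) * b \<le> a powr (q - 1) * (\<epsilon> * a)" by (intro mult_left_mono) auto
    also have "\<dots> = \<epsilon> * a powr q" using ab by (cases "a = 0") (simp_all add: powr_diff)
    finally show ?thesis by (simp add: add_increasing2)
  next
    case False
    then have b: "0 < b" using ab \<epsilon> by (smt (verit) mult_nonneg_nonneg)
    have "a powr (q - 1) * b \<le> ((1/\<epsilon>) * b) powr (q - 1) * b"
      using False ab \<epsilon> q by (intro mult_right_mono powr_mono2) (auto simp: field_simps)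
    also have "\<dots> = (1/\<epsilon>) powr (q - 1) * (b powr (q - 1) * b)" using \<epsilon> b by (subst powr_mult) auto
    also have "b powr (q - 1) * b = b powr q" using b by (simp add: powr_diff)
    finally show ?thesis using \<epsilon> by (simp add: add_increasing)
  qed
  \<comment> \<open>The pathwise form of Doob's inequality: \<open>T\<close> is a submartingale along the environment.\<close>
  define T where "T = (\<lambda>L \<omega> i. q * (maxN L \<omega> i powr (q - 1) * \<bar>N L \<omega> i\<bar>) - (q - 1) * maxN L \<omega> i powr q)"
  have bounded_meas_maxp: "bounded_meas (\<lambda>\<omega>. maxN L \<omega> i powr q)" "bounded_meas (\<lambda>\<omega>. maxN L \<omega> i powr (q - 1))" for L i
    using q0 maxN_nonneg by (auto intro!: bounded_meas_powr)
  have bounded_meas_T: "bounded_meas (\<lambda>\<omega>. T L \<omega> i)" for L i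
    unfolding T_def by (intro bounded_meas_diff bounded_meas_mult bounded_meas_const bounded_meas_abs bounded_meas_N bounded_meas_maxp)
  have T_nonneg: "0 \<le> \<mu>.expectation (\<lambda>\<omega>. T L \<omega> i)" for L i
  proof (induction i)
    case 0
    then show ?case using q by (simp add: T_def)
  next
    case (Suc i)
    let ?M = "\<lambda>\<omega>. maxN L \<omega> i"
    \<comment> \<open>The factors beside r - m involve only sites left of L + i, so this linear
      minorant of the increment of \<open>T\<close> has mean zero.\<close>
    let ?Z = "\<lambda>\<omega>. (r \<omega> (L + int i) - m) * (q * ?M \<omega> powr (q - 1) * sgn (N L \<omega> i) * (v + D L \<omega> i))"
    have bZ: "bounded_meas ?Z" by (intro bounded_meas_mult bounded_meas_diff bounded_meas_add bounded_meas_const bounded_meas_r bounded_meas_sgn bounded_meas_N bounded_meas_D bounded_meas_maxp)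
    have "T L \<omega> i + ?Z \<omega> \<le> T L \<omega> (Suc i)" for \<omega>
    proof -
      let ?x = "\<bar>N L \<omega> i\<bar>" and ?y = "\<bar>N L \<omega> (Suc i)\<bar>"
      have "sgn (N L \<omega> i) * ((r \<omega> (L + int i) - m) * (v + D L \<omega> i)) \<le> ?y - ?x"
      proof -
        have "sgn x * d \<le> \<bar>x + d\<bar> - \<bar>x\<bar>" for x d :: real
          by (cases x "0 :: real" rule: linorder_cases) auto
        then show ?thesis unfolding N_Suc .
      qed
      then have "q * ?M \<omega> powr (q - 1) * (sgn (N L \<omega> i) * ((r \<omega> (L + int i) - m) * (v + D L \<omega> i)))
          \<le> q * ?M \<omega> powr (q - 1) * (?y - ?x)"
        using q by (intro mult_left_mono) auto
      then have Z: "?Z \<omega> \<le> q * ?M \<omega> powr (q - 1) * (?y - ?x)" by (simp add: mult_ac)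
      show ?thesis
      proof (cases "?y \<le> ?M \<omega>")
        case True
        then have "maxN L \<omega> (Suc i) = ?M \<omega>" by simp
        then show ?thesis using Z by (simp add: T_def algebra_simps)
      next
        case False
        then have M: "maxN L \<omega> (Suc i) = ?y" by simp
        \<comment> \<open>At a new maximum \<open>T\<close> equals |N|^q, whereas the expression
          with the old maximum kept is the value at \<open>?y\<close> of the tangent to x^q at that
          maximum. Convexity puts the tangent below.\<close>
        have "?M \<omega> powr q + q * ?M \<omega> powr (q - 1) * (?y - ?M \<omega>) \<le> ?y powr q"
          using q maxN_nonneg[of L \<omega> i] False by (intro powr_tangent_le) auto
        moreover have "?M \<omega> powr (q - 1) * ?M \<omega> = ?M \<omega> powr q"
          using maxN_nonneg[of L \<omega> i] by (cases "?M \<omega> = 0") (simp_all add: powr_diff)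
        moreover have "?y powr (q - 1) * ?y = ?y powr q"
          by (cases "?y = 0") (simp_all add: powr_diff)
        ultimately have "?M \<omega> powr q + q * (?M \<omega> powr (q - 1) * ?y) - q * ?M \<omega> powr q \<le> ?y powr q"
          "T L \<omega> (Suc i) = ?y powr q"
          unfolding T_def M by (simp_all add: algebra_simps)
        then show ?thesis using Z by (simp add: T_def algebra_simps)
      qed
    qed
    then have "\<mu>.expectation (\<lambda>\<omega>. T L \<omega> i + ?Z \<omega>) \<le> \<mu>.expectation (\<lambda>\<omega>. T L \<omega> (Suc i))"
      by (intro expectation_mono bounded_meas_add bounded_meas_T bZ)
    moreover have "\<mu>.expectation (\<lambda>\<omega>. T L \<omega> i + ?Z \<omega>) = \<mu>.expectation (\<lambda>\<omega>. T L \<omega> i) + \<mu>.expectation ?Z"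
      by (intro expectation_add bounded_meas_T bZ)
    moreover have "\<mu>.expectation ?Z = 0"
      by (intro expectation_centred_r_mult bounded_meas_mult bounded_meas_add bounded_meas_const bounded_meas_sgn bounded_meas_N bounded_meas_D bounded_meas_maxp)
        (auto simp: N_upd D_upd maxN_upd)
    ultimately show ?case using Suc by simp
  qed
  show thesis
  proof (rule that[of C])
    show "0 \<le> C" using q by (simp add: C_def)
    fix L i
    let ?M = "\<lambda>\<omega>. maxN L \<omega> i powr q" and ?X = "\<lambda>\<omega>. \<bar>N L \<omega> i\<bar> powr q"
    let ?K = "q * (1/\<epsilon>) powr (q - 1)"
    have bX: "bounded_meas ?X" using q0 by auto
    have "T L \<omega> i + (q - 1) / 2 * ?M \<omega> \<le> ?K * ?X \<omega>" for \<omega>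
    proof -
      have "q * (maxN L \<omega> i powr (q - 1) * \<bar>N L \<omega> i\<bar>) \<le> q * (\<epsilon> * ?M \<omega> + (1/\<epsilon>) powr (q - 1) * ?X \<omega>)"
        using q0 by (intro mult_left_mono young maxN_nonneg) auto
      also have "\<dots> = (q - 1) / 2 * ?M \<omega> + ?K * ?X \<omega>" by (simp add: distrib_left \<epsilon> flip: mult.assoc)
      finally show ?thesis by (simp add: T_def field_simps)
    qed
    then have "\<mu>.expectation (\<lambda>\<omega>. T L \<omega> i + (q - 1) / 2 * ?M \<omega>) \<le> \<mu>.expectation (\<lambda>\<omega>. ?K * ?X \<omega>)"
      by (intro expectation_mono bounded_meas_add bounded_meas_T bounded_meas_mult bounded_meas_const bounded_meas_maxp bX)
    moreover have "\<mu>.expectation (\<lambda>\<omega>. T L \<omega> i + (q - 1) / 2 * ?M \<omega>) =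
        \<mu>.expectation (\<lambda>\<omega>. T L \<omega> i) + \<mu>.expectation (\<lambda>\<omega>. (q - 1) / 2 * ?M \<omega>)"
      by (intro expectation_add bounded_meas_T bounded_meas_mult bounded_meas_const bounded_meas_maxp)
    ultimately have "(q - 1) / 2 * \<mu>.expectation ?M \<le> ?K * \<mu>.expectation ?X"
      using T_nonneg[of L i] by simp
    then show "\<mu>.expectation ?M \<le> C * \<mu>.expectation ?X"
      using q by (simp add: C_def field_simps)
  qed
qed

text \<open>The corrector will be evaluated at the position of the walk, which is correlated with
  the environment, so one \<open>H\<close> must dominate all i <= I at once. Doob's inequality
  handles the martingale part. For the boundary term in \<open>A_N\<close> the maximum of the q-th
  powers of \<open>D\<close> is replaced by their sum, of order I <= I^(q/2).\<close>

lemma A_maximal_moment: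
  obtains C where "0 \<le> C" and "\<And>L I. 1 \<le> I \<Longrightarrow> \<exists>H. bounded_meas H \<and> (\<forall>i\<le>I. \<forall>\<omega>. \<bar>A L \<omega> i\<bar> powr q \<le> H \<omega>) \<and>
    \<mu>.expectation H \<le> C * real I powr (q/2)"
proof -
  obtain CD where CD: "0 \<le> CD" "\<And>L j. \<mu>.expectation (\<lambda>\<omega>. D L \<omega> j powr q) \<le> CD"
    using D_moment by blast
  obtain CN where CN: "0 \<le> CN" "\<And>L i. 1 \<le> i \<Longrightarrow> \<mu>.expectation (\<lambda>\<omega>. \<bar>N L \<omega> i\<bar> powr q) \<le> CN * i powr (q/2)"
    using N_moment by blast
  obtain CM where CM: "0 \<le> CM" "\<And>L i. \<mu>.expectation (\<lambda>\<omega>. maxN L \<omega> i powr q)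
    \<le> CM * \<mu>.expectation (\<lambda>\<omega>. \<bar>N L \<omega> i\<bar> powr q)"
    using maxN_moment_le by blast
  define K where "K = (1 / (1 - m)) powr q * 2 powr q"
  have K: "0 \<le> K" by (simp add: K_def)
  define C where "C = K * (CM * CN + 2 powr q * (1 + 2 * CD))"
  show thesis
  proof (rule that[of C])
    show "0 \<le> C" using K CM CN CD by (simp add: C_def)
    fix L :: int and I :: nat assume I: "1 \<le> I"
    define H where "H = (\<lambda>\<omega>. K * (maxN L \<omega> I powr q + 2 powr q * (1 + (\<Sum>j\<le>I. D L \<omega> j powr q))))"
    have b: "bounded_meas (\<lambda>\<omega>. maxN L \<omega> I powr q)" using q maxN_nonneg by (auto intro!: bounded_meas_powr)
    have bH: "bounded_meas H" unfolding H_def by (intro bounded_meas_mult bounded_meas_const bounded_meas_add b bounded_meas_sum bounded_meas_D_powr)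
    have dom: "\<bar>A L \<omega> i\<bar> powr q \<le> H \<omega>" if i: "i \<le> I" for i \<omega>
    proof -
      have D0: "0 < D L \<omega> i" by (rule D_pos)
      have "(1 - m) * \<bar>A L \<omega> i\<bar> = \<bar>N L \<omega> i - m * (D L \<omega> i - 1)\<bar>"
        using A_N[of L \<omega> i] m_less by (metis abs_mult abs_of_nonneg diff_ge_0_iff_ge less_imp_le)
      also have "\<dots> \<le> \<bar>N L \<omega> i\<bar> + m * \<bar>D L \<omega> i - 1\<bar>"
        using abs_triangle_ineq4[of "N L \<omega> i" "m * (D L \<omega> i - 1)"] m_pos by (simp add: abs_mult)
      also have "m * \<bar>D L \<omega> i - 1\<bar> \<le> 1 * (1 + D L \<omega> i)"
        using m_pos m_less D0 by (intro mult_mono) auto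
      finally have "\<bar>A L \<omega> i\<bar> \<le> (1 / (1 - m)) * (maxN L \<omega> I + (1 + D L \<omega> i))"
        using m_less N_le_maxN[OF i, of L \<omega>] by (simp add: field_simps)
      then have "\<bar>A L \<omega> i\<bar> powr q \<le> ((1 / (1 - m)) * (maxN L \<omega> I + (1 + D L \<omega> i))) powr q"
        using q by (intro powr_mono2) auto
      also have "\<dots> = (1 / (1 - m)) powr q * (maxN L \<omega> I + (1 + D L \<omega> i)) powr q"
        using m_less D0 maxN_nonneg[of L \<omega> I] by (subst powr_mult) auto
      also have "\<dots> \<le> (1 / (1 - m)) powr q * (2 powr q * (maxN L \<omega> I powr q + (1 + D L \<omega> i) powr q))"
        using q D0 maxN_nonneg[of L \<omega> I] by (intro mult_left_mono powr_add_le) auto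
      also have "\<dots> = K * (maxN L \<omega> I powr q + (1 + D L \<omega> i) powr q)" by (simp add: K_def)
      also have "(1 + D L \<omega> i) powr q \<le> 2 powr q * (1 powr q + D L \<omega> i powr q)"
        using q D0 by (intro powr_add_le) auto
      also have "D L \<omega> i powr q \<le> (\<Sum>j\<le>I. D L \<omega> j powr q)"
        using i by (intro member_le_sum) auto
      finally show ?thesis using K by (simp add: H_def mult_left_mono)
    qed
    have "real I powr 1 \<le> real I powr (q/2)" using I q by (intro powr_mono) auto
    then have I1: "1 \<le> real I powr (q/2)" "real I \<le> real I powr (q/2)" using I by auto
    have "\<mu>.expectation H = K * (\<mu>.expectation (\<lambda>\<omega>. maxN L \<omega> I powr q) +
        2 powr q * (1 + (\<Sum>j\<le>I. \<mu>.expectation (\<lambda>\<omega>. D L \<omega> j powr q))))"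
    proof -
      have "\<mu>.expectation (\<lambda>\<omega>. \<Sum>j\<le>I. D L \<omega> j powr q) = (\<Sum>j\<le>I. \<mu>.expectation (\<lambda>\<omega>. D L \<omega> j powr q))"
        by (intro Bochner_Integration.integral_sum bounded_meas_integrable bounded_meas_D_powr)
      moreover have bs: "bounded_meas (\<lambda>\<omega>. \<Sum>j\<le>I. D L \<omega> j powr q)" by (intro bounded_meas_sum bounded_meas_D_powr)
      ultimately show ?thesis
        unfolding H_def
        by (simp add: expectation_add[OF b bounded_meas_mult[OF bounded_meas_const bounded_meas_add[OF bounded_meas_const bs]]]
            expectation_add[OF bounded_meas_const bs] \<mu>.prob_space)
    qed
    also have "\<dots> \<le> K * (CM * (CN * real I powr (q/2)) + 2 powr q * (real I powr (q/2) + (2 * real I powr (q/2)) * CD))"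
    proof (intro mult_left_mono add_mono K I1)
      show "\<mu>.expectation (\<lambda>\<omega>. maxN L \<omega> I powr q) \<le> CM * (CN * real I powr (q/2))"
        by (rule order_trans[OF CM(2) mult_left_mono[OF CN(2)[OF I] CM(1)]])
      have "(\<Sum>j\<le>I. \<mu>.expectation (\<lambda>\<omega>. D L \<omega> j powr q)) \<le> (\<Sum>j\<le>I. CD)" by (intro sum_mono CD)
      also have "\<dots> = (real I + 1) * CD" by simp
      also have "\<dots> \<le> (2 * real I powr (q/2)) * CD" using I1 CD by (intro mult_right_mono) auto
      finally show "(\<Sum>j\<le>I. \<mu>.expectation (\<lambda>\<omega>. D L \<omega> j powr q)) \<le> (2 * real I powr (q/2)) * CD" .
    qed auto
    also have "\<dots> = C * real I powr (q/2)" by (simp add: C_def algebra_simps)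
    finally show "\<exists>H. bounded_meas H \<and> (\<forall>i\<le>I. \<forall>\<omega>. \<bar>A L \<omega> i\<bar> powr q \<le> H \<omega>) \<and>
      \<mu>.expectation H \<le> C * real I powr (q/2)"
      using bH dom by blast
  qed
qed

end

section \<open>The annealed moment bound\<close>

text \<open>Strict convexity of exp. After division by exp (\<theta> y) it is the inequality 1 + u <
  exp u at u = -\<theta> y and u = (1 - \<theta>) y, whose mean with weights 1 - \<theta> and
  \<theta> vanishes.\<close>

lemma exp_weighted_less:
  fixes y \<theta> :: real
  assumes \<theta>: "0 < \<theta>" "\<theta> < 1" and y: "y \<noteq> 0"
  shows "exp (\<theta> * y) < 1 - \<theta> + \<theta> * exp y"
proof -
  have exp_gt: "1 + u < exp u" if "u \<noteq> 0" for u :: real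
  proof (cases "0 \<le> 1 + u / 2")
    case True
    have "1 + u < (1 + u / 2)\<^sup>2" using that by (simp add: power2_sum)
    also have "\<dots> \<le> (exp (u / 2))\<^sup>2" using True by (intro power_mono) auto
    also have "\<dots> = exp u" by (simp flip: exp_double)
    finally show ?thesis .
  next
    case False
    then have "1 + u < 0" by simp
    then show ?thesis using exp_gt_zero[of u] by linarith
  qed
  have "1 = (1 - \<theta>) * (1 - \<theta> * y) + \<theta> * (1 + (1 - \<theta>) * y)"
    by (simp add: algebra_simps)
  also have "\<dots> < (1 - \<theta>) * exp (- (\<theta> * y)) + \<theta> * exp ((1 - \<theta>) * y)"
    using exp_gt[of "- (\<theta> * y)"] exp_gt[of "(1 - \<theta>) * y"] \<theta> y
    by (intro add_strict_mono mult_strict_left_mono) auto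
  finally have "exp (\<theta> * y) * 1 < exp (\<theta> * y) *
      ((1 - \<theta>) * exp (- (\<theta> * y)) + \<theta> * exp ((1 - \<theta>) * y))"
    by (intro mult_strict_left_mono) auto
  also have "\<dots> = (1 - \<theta>) * (exp (\<theta> * y) * exp (- (\<theta> * y))) + \<theta> * (exp (\<theta> * y) * exp ((1 - \<theta>) * y))"
    by (simp add: algebra_simps)
  also have "exp (\<theta> * y) * exp (- (\<theta> * y)) = 1" by (simp flip: exp_add)
  also have "exp (\<theta> * y) * exp ((1 - \<theta>) * y) = exp y" by (simp add: algebra_simps flip: exp_add)
  finally show ?thesis by simp
qed

section \<open>Moments of \<open>rho\<close> below \<open>s\<close>, and annealed
  expectations\<close>

context elliptic_environment
begin

text \<open>The convex function t -> <rho^t> equals 1 at 0 and at \<open>s\<close>. If it reached 1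
  in between, the pointwise convexity inequality would be an equality almost surely; this forces rho
  = 1 and contradicts the negative mean of ln rho.\<close>

lemma integral_rho_powr_less_one:
  assumes s: "s_transient s \<alpha>" and t: "0 < t" "t < s"
  shows "(\<integral>w. rho w powr t \<partial>\<alpha>) < 1"
proof (rule ccontr)
  assume *: "\<not> (\<integral>w. rho w powr t \<partial>\<alpha>) < 1"
  define \<theta> where "\<theta> = t / s"
  have \<theta>: "0 < \<theta>" "\<theta> < 1" "\<theta> * s = t" using t by (auto simp: \<theta>_def)
  define f where "f = (\<lambda>w. 1 - \<theta> + \<theta> * rho (clip w) powr s - rho (clip w) powr t)"
  have f_pos: "0 < f w" if "rho (clip w) \<noteq> 1" for w
  proof -
    have "s * ln (rho (clip w)) \<noteq> 0" using that rho_clip[of w] t by simp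
    from exp_weighted_less[OF \<theta>(1,2) this] show ?thesis
      using rho_clip[of w] \<theta>(3) by (simp add: f_def powr_def flip: mult.assoc)
  qed
  have f_nonneg: "0 \<le> f w" for w
    using f_pos[of w] by (cases "rho (clip w) = 1") (auto simp: f_def)
  have int: "integrable \<alpha> (\<lambda>w. rho (clip w) powr u)" if "0 \<le> u" for u
    by (rule \<alpha>.integrable_const_bound[of _ "(1/c) powr u"])
      (use rho_clip that in \<open>auto simp: less_imp_le sets_alpha powr_mono2 intro!: AE_I2 cong: measurable_cong_sets\<close>)
  have "(\<integral>w. f w \<partial>\<alpha>) = 1 - \<theta> + \<theta> * (\<integral>w. rho w powr s \<partial>\<alpha>) - (\<integral>w. rho w powr t \<partial>\<alpha>)"
    unfolding f_def using int[of s] int[of t] t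
    by (simp add: integral_rho_clip_powr \<alpha>.prob_space)
  also have "\<dots> \<le> 0" using * s by (simp add: s_transient_def)
  finally have "(\<integral>w. f w \<partial>\<alpha>) = 0"
    using integral_nonneg_AE[of f \<alpha>] f_nonneg by (simp add: order_antisym)
  moreover have "integrable \<alpha> f" unfolding f_def using int[of s] int[of t] t by simp
  ultimately have "AE w in \<alpha>. f w = 0"
    using integral_nonneg_eq_0_iff_AE[of \<alpha> f] f_nonneg by simp
  then have "AE w in \<alpha>. ln (rho w) = 0"
    using AE_clip
  proof eventually_elim
    case (elim w)
    then show ?case using f_pos[of w] by (cases "rho w = 1") auto
  qed
  then have "(\<integral>w. ln (rho w) \<partial>\<alpha>) = (\<integral>w. 0 \<partial>\<alpha>)"
    by (intro integral_cong_AE) (auto simp: sets_alpha cong: measurable_cong_sets)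
  then show False using s by (simp add: s_transient_def)
qed

lemma bounded_meas_clip [intro!]: "bounded_meas (\<lambda>\<omega>. clip (\<omega> x))"
proof -
  have "(\<lambda>\<omega>. clip (\<omega> x)) \<in> borel_measurable (env_law \<alpha>)" by measurable
  moreover have "\<bar>clip (\<omega> x)\<bar> \<le> 1" for \<omega> using clip_bounds[of "\<omega> x"] by simp
  ultimately show ?thesis unfolding bounded_meas_def by blast
qed

lemma clip_unit: "clip w \<in> {0..1}"
  using clip_bounds[of w] by simp

lemma bounded_meas_quenched_mean:
  "(\<And>x. bounded_meas (\<lambda>\<omega>. F \<omega> x)) \<Longrightarrow> bounded_meas (\<lambda>\<omega>. quenched_mean (\<lambda>x. clip (\<omega> x)) k (F \<omega>))"
proof (induction k arbitrary: F)
  case (Suc k)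
  show ?case unfolding quenched_mean.simps
    by (rule Suc.IH) (intro bounded_meas_add bounded_meas_mult bounded_meas_diff bounded_meas_const bounded_meas_clip Suc.prems)
qed simp

lemma nn_integral_annealed_law:
  assumes f: "\<And>y. 0 \<le> f y"
  shows "(\<integral>\<^sup>+z. ennreal (f (z n)) \<partial>annealed_law \<alpha>) =
    ennreal (\<mu>.expectation (\<lambda>\<omega>. quenched_mean (\<lambda>x. clip (\<omega> x)) n f))"
proof -
  have m: "(\<lambda>z. ennreal (f (z n))) \<in> borel_measurable path_space" by measurable
  have "(\<integral>\<^sup>+z. ennreal (f (z n)) \<partial>annealed_law \<alpha>) =
      (\<integral>\<^sup>+\<omega>. (\<integral>\<^sup>+z. ennreal (f (z n)) \<partial>quenched_law \<omega>) \<partial>env_law \<alpha>)"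
    unfolding annealed_law_def
    by (rule nn_integral_bind[OF m measurable_quenched_law_env_law[OF env]])
  also have "\<dots> = (\<integral>\<^sup>+\<omega>. ennreal (quenched_mean (\<lambda>x. clip (\<omega> x)) n f) \<partial>env_law \<alpha>)"
  proof (rule nn_integral_cong_AE)
    show "AE \<omega> in env_law \<alpha>. (\<integral>\<^sup>+z. ennreal (f (z n)) \<partial>quenched_law \<omega>) =
        ennreal (quenched_mean (\<lambda>x. clip (\<omega> x)) n f)"
      using AE_clip_env
    proof eventually_elim
      case (elim \<omega>)
      then show ?case
        using nn_integral_quenched_law[of "\<lambda>x. clip (\<omega> x)" f n] clip_unit f by simp
    qed
  qed
  also have "\<dots> = ennreal (\<mu>.expectation (\<lambda>\<omega>. quenched_mean (\<lambda>x. clip (\<omega> x)) n f))"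
    using f by (intro nn_integral_eq_integral bounded_meas_integrable bounded_meas_quenched_mean bounded_meas_const AE_I2
        quenched_mean_nonneg clip_unit)
  finally show ?thesis .
qed

end

section \<open>Moments of the corrected walk and of the walk itself\<close>

context subunit_moment_environment
begin

text \<open>The quenched bound and the Green estimate leave 2n + 1 sites, each with expectation at
  most \<open>B\<close>, and n * n^(q/2 - 1) = n^(q/2). The start \<open>L\<close> lies left of
  every site reached in n steps, so the recursion for the increments is available wherever the walk
  can be.\<close>

lemma quenched_corrected_moment:
  obtains C where "0 \<le> C" and "\<And>n L S. 1 \<le> n \<Longrightarrow> L = - int n - 2 \<Longrightarrow>
    S = (\<lambda>\<omega> x. of_int x + A L \<omega> (nat (x - L)) - A L \<omega> (nat (- L))) \<Longrightarrow>
    \<mu>.expectation (\<lambda>\<omega>. quenched_mean (\<lambda>x. clip (\<omega> x)) n (\<lambda>x. \<bar>S \<omega> x - v * real n\<bar> powr q))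
      \<le> C * real n powr (q/2)"
proof -
  obtain CM where CM: "0 \<le> CM" "\<And>w S v n. (\<And>x. w x \<in> {0..1}) \<Longrightarrow> S 0 = 0 \<Longrightarrow>
    (\<And>x. \<bar>x\<bar> < int n \<Longrightarrow> w x * (S (x + 1) - S x - v) + (1 - w x) * (S (x - 1) - S x - v) = 0) \<Longrightarrow>
    quenched_mean w n (\<lambda>x. \<bar>S x - v * n\<bar> powr q) \<le> CM * n powr (q/2 - 1) * (\<Sum>k<n. quenched_mean w k
      (\<lambda>x. w x * \<bar>S (x + 1) - S x - v\<bar> powr q + (1 - w x) * \<bar>S (x - 1) - S x - v\<bar> powr q))"
    using quenched_martingale_moment[OF q] by blast
  obtain CD where CD: "0 \<le> CD" "\<And>L j. \<mu>.expectation (\<lambda>\<omega>. D L \<omega> j powr q) \<le> CD"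
    using D_moment by blast
  define K where "K = ((1 / c) powr q + 1) * 2 powr q"
  define B where "B = (1 + 1 / c) * (K * (1 + CD) / (1 - m))"
  have K: "0 \<le> K" by (simp add: K_def)
  have B: "0 \<le> B" using K CD c_pos m_less by (simp add: B_def)
  show thesis
  proof (rule that[of "CM * (3 * B)"])
    show "0 \<le> CM * (3 * B)" using CM B by simp
    fix n :: nat and L :: int and S :: "(int \<Rightarrow> real) \<Rightarrow> int \<Rightarrow> real"
    assume n: "1 \<le> n" and L: "L = - int n - 2"
      and S: "S = (\<lambda>\<omega> x. of_int x + A L \<omega> (nat (x - L)) - A L \<omega> (nat (- L)))"
    \<comment> \<open>A barrier that the walk cannot reach within n steps; the Green equation at |x|
      <= n reads \<open>u\<close> only up to n + 1.\<close>
    define R where "R = int n + 2"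
    define \<Delta> where "\<Delta> = (\<lambda>\<omega> x. D L \<omega> (nat (x - L)))"
    define u where "u = (\<lambda>\<omega> x. U R \<omega> (nat (R - x)))"
    define G where "G = (\<lambda>\<omega> x. (1 + r \<omega> x) * u \<omega> x)"
    define f where "f = (\<lambda>\<omega> x. K * (1 + \<Delta> \<omega> x powr q))"
    have \<Delta>_pos: "0 < \<Delta> \<omega> x" for \<omega> x by (simp add: \<Delta>_def D_pos)
    have f_nonneg: "0 \<le> f \<omega> x" for \<omega> x using K by (simp add: f_def)
    have S_step: "S \<omega> (x + 1) - S \<omega> x = \<Delta> \<omega> (x + 1)"
      and \<Delta>_step: "\<Delta> \<omega> (x + 1) = v * (1 + r \<omega> x) + r \<omega> x * \<Delta> \<omega> x" if "L \<le> x" for \<omega> x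
    proof -
      have "nat (x + 1 - L) = Suc (nat (x - L))" "L + int (nat (x - L)) = x" using that by auto
      then show "S \<omega> (x + 1) - S \<omega> x = \<Delta> \<omega> (x + 1)"
        "\<Delta> \<omega> (x + 1) = v * (1 + r \<omega> x) + r \<omega> x * \<Delta> \<omega> x"
        by (simp_all add: S \<Delta>_def A_def)
    qed
    \<comment> \<open>The compensated step up is r times the one down with opposite sign, and the
      jump probabilities up and down are in the ratio 1 : r, so the mean is zero.\<close>
    have up: "S \<omega> (x + 1) - S \<omega> x - v = r \<omega> x * (v + \<Delta> \<omega> x)"
      and down: "S \<omega> (x - 1) - S \<omega> x - v = - (v + \<Delta> \<omega> x)" if "\<bar>x\<bar> < int n" for \<omega> x
    proof -
      from that have "L \<le> x" "L \<le> x - 1" by (auto simp: L)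
      then show "S \<omega> (x + 1) - S \<omega> x - v = r \<omega> x * (v + \<Delta> \<omega> x)"
        "S \<omega> (x - 1) - S \<omega> x - v = - (v + \<Delta> \<omega> x)"
        using S_step[of x \<omega>] S_step[of "x - 1" \<omega>] \<Delta>_step[of x \<omega>] by (auto simp: algebra_simps)
    qed
    \<comment> \<open>In fact an equality: the recursion of \<open>u\<close> at x and at x + 1
      leaves of_bool (x = 0) + of_bool (0 < x) - of_bool (0 \<le> x) = 0.\<close>
    have green: "of_bool (x = 0) + clip (\<omega> (x - 1)) * G \<omega> (x - 1) + (1 - clip (\<omega> (x + 1))) * G \<omega> (x + 1) \<le> G \<omega> x"
      if x: "\<bar>x\<bar> \<le> int n" for \<omega> x
    proof -
      have 1: "clip (\<omega> y) * G \<omega> y = u \<omega> y" for y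
        using clip_r(1)[of \<omega> y] by (simp add: G_def flip: mult.assoc)
      have 2: "(1 - clip (\<omega> y)) * G \<omega> y = r \<omega> y * u \<omega> y" for y
        using 1[of y] unfolding clip_r(2) by (simp add: mult_ac)
      have u_step: "u \<omega> (y - 1) = of_bool (0 < y) + r \<omega> y * u \<omega> y" if "y \<le> R" for y
      proof -
        have "nat (R - (y - 1)) = Suc (nat (R - y))" "R - int (nat (R - y)) = y" using that by auto
        moreover have "int (nat (R - y)) < R \<longleftrightarrow> 0 < y" using that by auto
        ultimately show ?thesis by (simp add: u_def)
      qed
      have "u \<omega> (x - 1) = of_bool (0 < x) + r \<omega> x * u \<omega> x"
        "u \<omega> x = of_bool (0 \<le> x) + r \<omega> (x + 1) * u \<omega> (x + 1)"
        using u_step[of x] u_step[of "x + 1"] x by (auto simp: R_def)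
      then show ?thesis unfolding 1 2 by (auto simp: G_def algebra_simps of_bool_def)
    qed
    have u_nonneg: "0 \<le> u \<omega> x" for \<omega> x by (simp add: u_def U_nonneg)
    have G_nonneg: "0 \<le> G \<omega> x" for \<omega> x using u_nonneg r_bounds[of \<omega> x] by (simp add: G_def)
    let ?w = "\<lambda>\<omega> x. clip (\<omega> x)"
    have bounded_meas_f: "bounded_meas (\<lambda>\<omega>. f \<omega> x)" for x
      unfolding f_def \<Delta>_def by (intro bounded_meas_mult bounded_meas_add bounded_meas_const bounded_meas_D_powr)
    have bounded_meas_G: "bounded_meas (\<lambda>\<omega>. G \<omega> x)" for x
      unfolding G_def u_def by (intro bounded_meas_mult bounded_meas_add bounded_meas_const bounded_meas_r bounded_meas_U)
    have bounded_meas_S: "bounded_meas (\<lambda>\<omega>. S \<omega> x)" for x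
      unfolding S A_def by (intro bounded_meas_add bounded_meas_diff bounded_meas_const bounded_meas_sum bounded_meas_D)
    have pointwise: "quenched_mean (?w \<omega>) n (\<lambda>x. \<bar>S \<omega> x - v * real n\<bar> powr q)
        \<le> CM * n powr (q/2 - 1) * (\<Sum>x\<in>{-int n..int n}. G \<omega> x * f \<omega> x)" for \<omega>
    proof -
      have "quenched_mean (?w \<omega>) n (\<lambda>x. \<bar>S \<omega> x - v * real n\<bar> powr q) \<le> CM * n powr (q/2 - 1) *
        (\<Sum>k<n. quenched_mean (?w \<omega>) k (\<lambda>x. ?w \<omega> x * \<bar>S \<omega> (x + 1) - S \<omega> x - v\<bar> powr q
            + (1 - ?w \<omega> x) * \<bar>S \<omega> (x - 1) - S \<omega> x - v\<bar> powr q))"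
      proof (rule CM(2)[OF clip_unit])
        show "S \<omega> 0 = 0" by (simp add: S)
        fix x :: int assume x: "\<bar>x\<bar> < int n"
        show "?w \<omega> x * (S \<omega> (x + 1) - S \<omega> x - v) + (1 - ?w \<omega> x) * (S \<omega> (x - 1) - S \<omega> x - v) = 0"
          unfolding up[OF x] down[OF x] clip_r(2) by (simp add: algebra_simps)
      qed
      also have "\<dots> \<le> CM * n powr (q/2 - 1) * (\<Sum>k<n. quenched_mean (?w \<omega>) k (f \<omega>))"
      proof (intro mult_left_mono sum_mono quenched_mean_mono clip_unit)
        fix k x assume k: "k \<in> {..<n}" and "\<bar>x\<bar> \<le> int k"
        then have x: "\<bar>x\<bar> < int n" by simp
        have v\<Delta>: "0 \<le> v + \<Delta> \<omega> x" using v_pos \<Delta>_pos[of \<omega> x] by simp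
        have "?w \<omega> x * \<bar>S \<omega> (x + 1) - S \<omega> x - v\<bar> powr q + (1 - ?w \<omega> x) * \<bar>S \<omega> (x - 1) - S \<omega> x - v\<bar> powr q
          = ?w \<omega> x * (r \<omega> x powr q * (v + \<Delta> \<omega> x) powr q) + (1 - ?w \<omega> x) * (v + \<Delta> \<omega> x) powr q"
          unfolding up[OF x] down[OF x] abs_minus_cancel using v\<Delta> r_bounds[of \<omega> x] by (simp add: abs_mult powr_mult)
        also have "\<dots> \<le> 1 * ((1 / c) powr q * (v + \<Delta> \<omega> x) powr q) + 1 * (v + \<Delta> \<omega> x) powr q"
          using clip_bounds[of "\<omega> x"] r_bounds[of \<omega> x] q v\<Delta>
          by (intro add_mono mult_mono powr_mono2) auto
        also have "\<dots> = ((1 / c) powr q + 1) * (v + \<Delta> \<omega> x) powr q" by (simp add: algebra_simps)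
        also have "\<dots> \<le> ((1 / c) powr q + 1) * (1 + \<Delta> \<omega> x) powr q"
          using v\<Delta> v_le q by (intro mult_left_mono powr_mono2) auto
        also have "\<dots> \<le> ((1 / c) powr q + 1) * (2 powr q * (1 powr q + \<Delta> \<omega> x powr q))"
          using q \<Delta>_pos[of \<omega> x] by (intro mult_left_mono powr_add_le) auto
        finally show "?w \<omega> x * \<bar>S \<omega> (x + 1) - S \<omega> x - v\<bar> powr q
            + (1 - ?w \<omega> x) * \<bar>S \<omega> (x - 1) - S \<omega> x - v\<bar> powr q \<le> f \<omega> x"
          by (simp add: f_def K_def mult.assoc)
      qed (use CM in auto)
      also have "(\<Sum>k<n. quenched_mean (?w \<omega>) k (f \<omega>)) \<le> (\<Sum>k\<le>n. quenched_mean (?w \<omega>) k (f \<omega>))"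
        by (intro sum_mono2 quenched_mean_nonneg clip_unit f_nonneg) auto
      also have "\<dots> \<le> (\<Sum>x\<in>{-int n..int n}. G \<omega> x * f \<omega> x)"
        by (rule sum_quenched_mean_le_green[OF clip_unit f_nonneg G_nonneg green order_refl])
      finally show ?thesis using CM by (simp add: mult_left_mono)
    qed
    \<comment> \<open>\<open>f\<close> reads sites left of x and \<open>u\<close> sites right of x;
      the factor 1 + r at x itself is bounded by ellipticity.\<close>
    have Gf: "\<mu>.expectation (\<lambda>\<omega>. G \<omega> x * f \<omega> x) \<le> B" if x: "\<bar>x\<bar> \<le> int n" for x
    proof -
      have b: "bounded_meas (\<lambda>\<omega>. u \<omega> x * f \<omega> x)" unfolding u_def by (intro bounded_meas_mult bounded_meas_U bounded_meas_f)
      have "G \<omega> x * f \<omega> x \<le> (1 + 1 / c) * (u \<omega> x * f \<omega> x)" for \<omega>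
        unfolding G_def mult.assoc using r_bounds[of \<omega> x] u_nonneg[of \<omega> x] f_nonneg[of \<omega> x]
        by (intro mult_right_mono) auto
      then have "\<mu>.expectation (\<lambda>\<omega>. G \<omega> x * f \<omega> x) \<le> \<mu>.expectation (\<lambda>\<omega>. (1 + 1 / c) * (u \<omega> x * f \<omega> x))"
        by (intro expectation_mono bounded_meas_mult bounded_meas_const bounded_meas_G bounded_meas_f b)
      also have "\<dots> = (1 + 1 / c) * \<mu>.expectation (\<lambda>\<omega>. u \<omega> x * f \<omega> x)" by simp
      also have "\<mu>.expectation (\<lambda>\<omega>. u \<omega> x * f \<omega> x) \<le> \<mu>.expectation (\<lambda>\<omega>. f \<omega> x) / (1 - m)"
        unfolding u_def
      proof (rule expectation_U_mult_le[OF bounded_meas_f f_nonneg])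
        fix \<omega> y a assume "R - int (nat (R - x)) < y"
        moreover have "int (nat (R - x)) = R - x" "int (nat (x - L)) = x - L"
          using x by (auto simp: R_def L)
        ultimately have "L + int (nat (x - L)) \<le> y" by linarith
        then show "f (fun_upd \<omega> y a) x = f \<omega> x" by (simp only: f_def \<Delta>_def D_upd)
      qed
      also have "\<mu>.expectation (\<lambda>\<omega>. f \<omega> x) = K * (1 + \<mu>.expectation (\<lambda>\<omega>. D L \<omega> (nat (x - L)) powr q))"
        by (simp add: f_def \<Delta>_def expectation_add[OF bounded_meas_const bounded_meas_D_powr])
      also have "\<dots> \<le> K * (1 + CD)" using K by (intro mult_left_mono add_mono CD) auto
      finally show ?thesis using c_pos m_less by (simp add: B_def mult_left_mono divide_right_mono)
    qed
    have "\<mu>.expectation (\<lambda>\<omega>. quenched_mean (?w \<omega>) n (\<lambda>x. \<bar>S \<omega> x - v * real n\<bar> powr q))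
        \<le> \<mu>.expectation (\<lambda>\<omega>. CM * n powr (q/2 - 1) * (\<Sum>x\<in>{-int n..int n}. G \<omega> x * f \<omega> x))"
      using q by (intro expectation_mono pointwise bounded_meas_quenched_mean bounded_meas_mult bounded_meas_sum bounded_meas_const bounded_meas_G bounded_meas_f
          bounded_meas_abs_powr bounded_meas_diff bounded_meas_S) auto
    also have "\<dots> = CM * n powr (q/2 - 1) * (\<Sum>x\<in>{-int n..int n}. \<mu>.expectation (\<lambda>\<omega>. G \<omega> x * f \<omega> x))"
      by (simp add: Bochner_Integration.integral_sum bounded_meas_integrable[OF bounded_meas_mult[OF bounded_meas_G bounded_meas_f]])
    also have "\<dots> \<le> CM * n powr (q/2 - 1) * (\<Sum>x\<in>{-int n..int n}. B)"
      using CM by (intro mult_left_mono sum_mono Gf) auto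
    also have "(\<Sum>x\<in>{-int n..int n}. B) = (2 * real n + 1) * B" by simp
    also have "\<dots> \<le> (3 * real n) * B" using n B by (intro mult_right_mono) auto
    also have "CM * n powr (q/2 - 1) * ((3 * real n) * B) = CM * (3 * B) * (n powr 1 * n powr (q/2 - 1))"
      by simp
    also have "n powr 1 * n powr (q/2 - 1) = n powr (q/2)" by (simp only: flip: powr_add) simp
    finally show "\<mu>.expectation (\<lambda>\<omega>. quenched_mean (?w \<omega>) n (\<lambda>x. \<bar>S \<omega> x - v * real n\<bar> powr q))
        \<le> CM * (3 * B) * real n powr (q/2)"
      using CM by (simp add: mult_left_mono)
  qed
qed

text \<open>The position differs from \<open>S\<close> by two values of \<open>A\<close> with
  indices at most 2n + 2. The dominating \<open>H\<close> does not depend on the position, so it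
  leaves the quenched mean as a constant. The factor 6 comes from 2n + 4 <= 6n.\<close>

lemma annealed_moment:
  obtains C where "0 \<le> C" and "\<And>n. 1 \<le> n \<Longrightarrow>
    \<mu>.expectation (\<lambda>\<omega>. quenched_mean (\<lambda>x. clip (\<omega> x)) n (\<lambda>x. \<bar>of_int x - v * real n\<bar> powr q))
      \<le> C * real n powr (q/2)"
proof -
  obtain CS where CS: "0 \<le> CS" "\<And>n L S. 1 \<le> n \<Longrightarrow> L = - int n - 2 \<Longrightarrow>
    S = (\<lambda>\<omega> x. of_int x + A L \<omega> (nat (x - L)) - A L \<omega> (nat (- L))) \<Longrightarrow>
    \<mu>.expectation (\<lambda>\<omega>. quenched_mean (\<lambda>x. clip (\<omega> x)) n (\<lambda>x. \<bar>S \<omega> x - v * real n\<bar> powr q))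
      \<le> CS * real n powr (q/2)"
    using quenched_corrected_moment by blast
  obtain CA where CA: "0 \<le> CA" "\<And>L I. 1 \<le> I \<Longrightarrow> \<exists>H. bounded_meas H \<and> (\<forall>i\<le>I. \<forall>\<omega>. \<bar>A L \<omega> i\<bar> powr q \<le> H \<omega>) \<and>
    \<mu>.expectation H \<le> CA * real I powr (q/2)"
    using A_maximal_moment by blast
  define E where "E = 2 powr q * (2 powr q * 2)"
  show thesis
  proof (rule that[of "2 powr q * CS + E * (CA * 6 powr (q/2))"])
    show "0 \<le> 2 powr q * CS + E * (CA * 6 powr (q/2))" using CS CA by (simp add: E_def)
    fix n :: nat assume n: "1 \<le> n"
    define L where "L = - int n - 2"
    define S where "S = (\<lambda>\<omega> x. of_int x + A L \<omega> (nat (x - L)) - A L \<omega> (nat (- L)))"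
    obtain H where H: "bounded_meas H" "\<And>i \<omega>. i \<le> 2 * n + 4 \<Longrightarrow> \<bar>A L \<omega> i\<bar> powr q \<le> H \<omega>"
      "\<mu>.expectation H \<le> CA * real (2 * n + 4) powr (q/2)"
      using CA(2)[of "2 * n + 4" L] by auto
    let ?w = "\<lambda>\<omega> x. clip (\<omega> x)"
    let ?X = "\<lambda>\<omega>. quenched_mean (?w \<omega>) n (\<lambda>x. \<bar>S \<omega> x - v * real n\<bar> powr q)"
    have bX: "bounded_meas ?X"
      unfolding S_def A_def using q
      by (intro bounded_meas_quenched_mean bounded_meas_abs_powr bounded_meas_add bounded_meas_diff bounded_meas_const bounded_meas_sum bounded_meas_D) auto
    have "quenched_mean (?w \<omega>) n (\<lambda>x. \<bar>of_int x - v * real n\<bar> powr q) \<le> 2 powr q * ?X \<omega> + E * H \<omega>" for \<omega>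
    proof -
      have "quenched_mean (?w \<omega>) n (\<lambda>x. \<bar>of_int x - v * real n\<bar> powr q) \<le>
          quenched_mean (?w \<omega>) n (\<lambda>x. 2 powr q * \<bar>S \<omega> x - v * real n\<bar> powr q + E * H \<omega>)"
      proof (rule quenched_mean_mono[OF clip_unit])
        fix x :: int assume x: "\<bar>x\<bar> \<le> int n"
        let ?a = "A L \<omega> (nat (x - L))" and ?b = "A L \<omega> (nat (- L))"
        have "\<bar>of_int x - v * real n\<bar> \<le> \<bar>S \<omega> x - v * real n\<bar> + (\<bar>?a\<bar> + \<bar>?b\<bar>)"
          unfolding S_def by linarith
        then have "\<bar>of_int x - v * real n\<bar> powr q \<le> (\<bar>S \<omega> x - v * real n\<bar> + (\<bar>?a\<bar> + \<bar>?b\<bar>)) powr q"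
          using q by (intro powr_mono2) auto
        also have "\<dots> \<le> 2 powr q * (\<bar>S \<omega> x - v * real n\<bar> powr q + (\<bar>?a\<bar> + \<bar>?b\<bar>) powr q)"
          using q by (intro powr_add_le) auto
        also have "(\<bar>?a\<bar> + \<bar>?b\<bar>) powr q \<le> 2 powr q * (\<bar>?a\<bar> powr q + \<bar>?b\<bar> powr q)"
          using q by (intro powr_add_le) auto
        also have "\<bar>?a\<bar> powr q + \<bar>?b\<bar> powr q \<le> H \<omega> + H \<omega>"
          using x by (intro add_mono H) (auto simp: L_def)
        finally show "\<bar>of_int x - v * real n\<bar> powr q \<le> 2 powr q * \<bar>S \<omega> x - v * real n\<bar> powr q + E * H \<omega>"
          by (simp add: E_def algebra_simps)
      qed
      also have "\<dots> = 2 powr q * ?X \<omega> + E * H \<omega>"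
        using quenched_mean_linear[of "?w \<omega>" n "2 powr q" _ "E * H \<omega>" "\<lambda>_. 1"]
        by (simp add: quenched_mean_const)
      finally show ?thesis .
    qed
    then have "\<mu>.expectation (\<lambda>\<omega>. quenched_mean (?w \<omega>) n (\<lambda>x. \<bar>of_int x - v * real n\<bar> powr q))
        \<le> \<mu>.expectation (\<lambda>\<omega>. 2 powr q * ?X \<omega> + E * H \<omega>)"
      using q by (intro expectation_mono bounded_meas_quenched_mean bounded_meas_const bounded_meas_add bounded_meas_mult bX H)
    also have "\<dots> = 2 powr q * \<mu>.expectation ?X + E * \<mu>.expectation H"
      by (simp add: expectation_add[OF bounded_meas_mult[OF bounded_meas_const bX] bounded_meas_mult[OF bounded_meas_const H(1)]])
    also have "\<dots> \<le> 2 powr q * (CS * real n powr (q/2)) + E * (CA * (6 powr (q/2) * real n powr (q/2)))"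
    proof (intro add_mono mult_left_mono)
      show "\<mu>.expectation ?X \<le> CS * real n powr (q/2)"
        using n by (intro CS(2)) (auto simp: L_def S_def)
      have "real (2 * n + 4) powr (q/2) \<le> (6 * real n) powr (q/2)"
        using n q by (intro powr_mono2) auto
      then have "real (2 * n + 4) powr (q/2) \<le> 6 powr (q/2) * real n powr (q/2)"
        by (simp add: powr_mult)
      from order_trans[OF H(3) mult_left_mono[OF this CA(1)]]
      show "\<mu>.expectation H \<le> CA * (6 powr (q/2) * real n powr (q/2))" .
    qed (auto simp: E_def)
    finally show "\<mu>.expectation (\<lambda>\<omega>. quenched_mean (?w \<omega>) n (\<lambda>x. \<bar>of_int x - v * real n\<bar> powr q))
        \<le> (2 powr q * CS + E * (CA * 6 powr (q/2))) * real n powr (q/2)"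
      by (simp add: algebra_simps)
  qed
qed

end

section \<open>Convergence of moments\<close>

text \<open>Truncation through \<open>min\<close> keeps the power bounded and continuous, as weak
  convergence requires. Beyond \<open>K\<close> the negative exponent p - q gives |x|^(p - q) <=
  K^(p - q).\<close>

lemma truncated_powr_error:
  fixes x K p q :: real
  assumes "0 < p" "p < q" "0 < K"
  shows "0 \<le> \<bar>x\<bar> powr p - min \<bar>x\<bar> K powr p" "\<bar>x\<bar> powr p - min \<bar>x\<bar> K powr p \<le> K powr (p - q) * \<bar>x\<bar> powr q"
proof -
  show "0 \<le> \<bar>x\<bar> powr p - min \<bar>x\<bar> K powr p"
    using powr_mono2[of p "min \<bar>x\<bar> K" "\<bar>x\<bar>"] assms by simp
  show "\<bar>x\<bar> powr p - min \<bar>x\<bar> K powr p \<le> K powr (p - q) * \<bar>x\<bar> powr q"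
  proof (cases "\<bar>x\<bar> \<le> K")
    case False
    have "\<bar>x\<bar> powr p = \<bar>x\<bar> powr (p - q) * \<bar>x\<bar> powr q" by (simp flip: powr_add)
    also have "\<dots> \<le> K powr (p - q) * \<bar>x\<bar> powr q"
      using False assms by (intro mult_right_mono powr_mono2') auto
    finally show ?thesis using powr_ge_zero[of "min \<bar>x\<bar> K" p] by linarith
  qed (simp add: min_absorb1)
qed

lemma (in real_distribution) truncated_moment:
  assumes pq: "0 < p" "p < q" and K: "0 < K" and C: "0 \<le> C"
    and mom: "(\<integral>\<^sup>+y. ennreal (\<bar>y\<bar> powr q) \<partial>M) \<le> ennreal C"
  shows "(\<integral>\<^sup>+y. ennreal (\<bar>y\<bar> powr p) \<partial>M) = ennreal (expectation (\<lambda>y. \<bar>y\<bar> powr p))"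
    and "\<bar>expectation (\<lambda>y. \<bar>y\<bar> powr p) - expectation (\<lambda>y. min \<bar>y\<bar> K powr p)\<bar> \<le> K powr (p - q) * C"
proof -
  have iq: "integrable M (\<lambda>y. \<bar>y\<bar> powr q)"
    by (rule integrableI_nonneg) (use mom in \<open>auto intro: le_less_trans\<close>)
  have ip: "integrable M (\<lambda>y. \<bar>y\<bar> powr p)"
  proof (rule Bochner_Integration.integrable_bound[of M "\<lambda>y. 1 + \<bar>y\<bar> powr q"])
    show "integrable M (\<lambda>y. 1 + \<bar>y\<bar> powr q)" using iq by simp
    show "AE y in M. norm (\<bar>y\<bar> powr p) \<le> norm (1 + \<bar>y\<bar> powr q)"
    proof (rule AE_I2)
      fix y :: real
      show "norm (\<bar>y\<bar> powr p) \<le> norm (1 + \<bar>y\<bar> powr q)"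
      proof (cases "\<bar>y\<bar> \<le> 1")
        case True
        then have "\<bar>y\<bar> powr p \<le> 1" using pq powr_mono2[of p "\<bar>y\<bar>" 1] by simp
        then show ?thesis by (simp add: add_increasing2)
      next
        case False
        then have "\<bar>y\<bar> powr p \<le> \<bar>y\<bar> powr q" using pq by (intro powr_mono) auto
        then show ?thesis by simp
      qed
    qed
  qed simp
  have imin: "integrable M (\<lambda>y. min \<bar>y\<bar> K powr p)"
    by (rule integrable_const_bound[of _ "K powr p"]) (use pq K in \<open>auto intro!: AE_I2 powr_mono2\<close>)
  show "(\<integral>\<^sup>+y. ennreal (\<bar>y\<bar> powr p) \<partial>M) = ennreal (expectation (\<lambda>y. \<bar>y\<bar> powr p))"
    by (rule nn_integral_eq_integral[OF ip]) simp
  have "ennreal (expectation (\<lambda>y. \<bar>y\<bar> powr q)) \<le> ennreal C"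
    using mom by (subst nn_integral_eq_integral[OF iq, symmetric]) auto
  then have Cq: "expectation (\<lambda>y. \<bar>y\<bar> powr q) \<le> C" using C by simp
  have diff: "expectation (\<lambda>y. \<bar>y\<bar> powr p) - expectation (\<lambda>y. min \<bar>y\<bar> K powr p)
      = expectation (\<lambda>y. \<bar>y\<bar> powr p - min \<bar>y\<bar> K powr p)"
    using ip imin by simp
  moreover have "0 \<le> expectation (\<lambda>y. \<bar>y\<bar> powr p - min \<bar>y\<bar> K powr p)"
    using truncated_powr_error(1)[OF pq K] by (intro integral_nonneg_AE) auto
  moreover have "expectation (\<lambda>y. \<bar>y\<bar> powr p - min \<bar>y\<bar> K powr p)
      \<le> expectation (\<lambda>y. K powr (p - q) * \<bar>y\<bar> powr q)"
    using ip imin iq truncated_powr_error(2)[OF pq K] by (intro integral_mono) auto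
  moreover have "\<dots> \<le> K powr (p - q) * C"
    using Cq by (simp add: mult_left_mono)
  ultimately show "\<bar>expectation (\<lambda>y. \<bar>y\<bar> powr p) - expectation (\<lambda>y. min \<bar>y\<bar> K powr p)\<bar> \<le> K powr (p - q) * C"
    by linarith
qed

text \<open>Uniform integrability in quantitative form: cutting at \<open>K\<close> costs at most
  K^(p - q) C for the limit and for all n >= 1 alike, so one \<open>K\<close> serves them all and
  only truncated moments have to converge.\<close>

lemma weak_conv_imp_moment_conv:
  assumes N: "\<And>n. real_distribution (\<nu> n)" and M: "real_distribution M" and conv: "weak_conv_m \<nu> M"
    and pq: "0 < p" "p < q" and C: "0 \<le> C"
    and mom: "\<And>n. 1 \<le> n \<Longrightarrow> (\<integral>\<^sup>+y. ennreal (\<bar>y\<bar> powr q) \<partial>\<nu> n) \<le> ennreal C"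
    and momM: "(\<integral>\<^sup>+y. ennreal (\<bar>y\<bar> powr q) \<partial>M) \<le> ennreal C"
  shows "(\<lambda>n. \<integral>\<^sup>+y. ennreal (\<bar>y\<bar> powr p) \<partial>\<nu> n) \<longlonglongrightarrow> (\<integral>\<^sup>+y. ennreal (\<bar>y\<bar> powr p) \<partial>M)"
    and "(\<integral>\<^sup>+y. ennreal (\<bar>y\<bar> powr p) \<partial>M) < \<infinity>"
proof -
  let ?a = "\<lambda>\<nu>. integral\<^sup>L \<nu> (\<lambda>y. \<bar>y\<bar> powr p)" and ?b = "\<lambda>K \<nu>. integral\<^sup>L \<nu> (\<lambda>y. min \<bar>y\<bar> K powr p)"
  note tM = real_distribution.truncated_moment[OF M pq _ C momM]
  note tN = real_distribution.truncated_moment[OF N pq _ C mom]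
  have eqM: "(\<integral>\<^sup>+y. ennreal (\<bar>y\<bar> powr p) \<partial>M) = ennreal (?a M)" by (rule tM(1)[of 1]) simp
  then show "(\<integral>\<^sup>+y. ennreal (\<bar>y\<bar> powr p) \<partial>M) < \<infinity>" by simp
  have "(\<lambda>n. ?a (\<nu> n)) \<longlonglongrightarrow> ?a M"
  proof (rule LIMSEQ_I)
    fix e :: real assume e: "0 < e"
    have "((\<lambda>K. K powr (p - q) * C) \<longlongrightarrow> 0 * C) at_top"
      using pq by (intro tendsto_mult tendsto_neg_powr filterlim_ident tendsto_const) auto
    then have "\<forall>\<^sub>F K in at_top. K powr (p - q) * C < e / 3"
      using e by (intro order_tendstoD(2)[of _ 0]) auto
    then have "\<forall>\<^sub>F K in at_top. 0 < K \<and> K powr (p - q) * C < e / 3"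
      using eventually_gt_at_top[of 0] by eventually_elim auto
    then obtain K where K: "0 < K" "K powr (p - q) * C < e / 3"
      using eventually_happens'[OF trivial_limit_at_top_linorder] by blast
    have "(\<lambda>n. ?b K (\<nu> n)) \<longlonglongrightarrow> ?b K M"
    proof (rule weak_conv_imp_integral_bdd_continuous_conv[OF N M conv])
      show "isCont (\<lambda>y. min \<bar>y\<bar> K powr p) y" for y :: real
        using pq by (intro continuous_intros continuous_on_interior[of UNIV]) (auto intro!: continuous_on_powr' continuous_intros)
      show "norm (min \<bar>y\<bar> K powr p) \<le> K powr p" for y :: real
        using pq K by (auto intro!: powr_mono2)
    qed
    then obtain n0 where n0: "\<And>n. n \<ge> n0 \<Longrightarrow> \<bar>?b K (\<nu> n) - ?b K M\<bar> < e / 3"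
      using e LIMSEQ_D[of _ _ "e / 3"] by (metis real_norm_def zero_less_divide_iff zero_less_numeral)
    show "\<exists>no. \<forall>n\<ge>no. norm (?a (\<nu> n) - ?a M) < e"
    proof (intro exI allI impI)
      fix n assume "n \<ge> max 1 n0"
      then have "\<bar>?b K (\<nu> n) - ?b K M\<bar> < e / 3" "\<bar>?a (\<nu> n) - ?b K (\<nu> n)\<bar> < e / 3"
        using n0[of n] tN(2)[OF K(1), of n] K(2) by auto
      moreover have "\<bar>?a M - ?b K M\<bar> < e / 3" using tM(2)[OF K(1)] K(2) by simp
      ultimately show "norm (?a (\<nu> n) - ?a M) < e" by (simp add: abs_if split: if_splits)
    qed
  qed
  then have "(\<lambda>n. ennreal (?a (\<nu> n))) \<longlonglongrightarrow> ennreal (?a M)" by (rule tendsto_ennrealI)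
  moreover have "\<forall>\<^sub>F n in sequentially. ennreal (?a (\<nu> n)) = (\<integral>\<^sup>+y. ennreal (\<bar>y\<bar> powr p) \<partial>\<nu> n)"
    using eventually_ge_at_top[of 1] by eventually_elim (rule tN(1)[of 1, symmetric], auto)
  ultimately show "(\<lambda>n. \<integral>\<^sup>+y. ennreal (\<bar>y\<bar> powr p) \<partial>\<nu> n) \<longlonglongrightarrow> (\<integral>\<^sup>+y. ennreal (\<bar>y\<bar> powr p) \<partial>M)"
    unfolding eqM by (rule Lim_transform_eventually)
qed

section \<open>Absolute moments of the normal law and the conclusion\<close>

lemma std_normal_abs_moment_finite:
  assumes "0 \<le> q"
  shows "(\<integral>\<^sup>+y. ennreal (\<bar>y\<bar> powr q) \<partial>std_normal_distribution) < \<infinity>"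
proof -
  define k where "k = nat \<lceil>q\<rceil>"
  have k: "q \<le> real k" unfolding k_def by linarith
  interpret real_distribution std_normal_distribution by (rule real_dist_normal_dist)
  have "integrable std_normal_distribution (\<lambda>y. \<bar>y\<bar> ^ k)"
    using integrable_std_normal_moment_abs[of k]
    by (subst integrable_density) (auto simp: normal_density_nonneg)
  then have "integrable std_normal_distribution (\<lambda>y. 1 + \<bar>y\<bar> ^ k)" by simp
  then have "(\<integral>\<^sup>+y. ennreal (1 + \<bar>y\<bar> ^ k) \<partial>std_normal_distribution) < \<infinity>"
    by (subst nn_integral_eq_integral) auto
  moreover have "\<bar>y\<bar> powr q \<le> 1 + \<bar>y\<bar> ^ k" for y :: real
  proof (cases "\<bar>y\<bar> \<le> 1")
    case True
    then have "\<bar>y\<bar> powr q \<le> 1" using assms powr_mono2[of q "\<bar>y\<bar>" 1] by simp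
    then show ?thesis by (simp add: add_increasing2)
  next
    case False
    then have "\<bar>y\<bar> powr q \<le> \<bar>y\<bar> powr real k" using k by (intro powr_mono) auto
    also have "\<dots> = \<bar>y\<bar> ^ k" using False by (simp add: powr_realpow)
    finally show ?thesis by simp
  qed
  then have "(\<integral>\<^sup>+y. ennreal (\<bar>y\<bar> powr q) \<partial>std_normal_distribution)
      \<le> (\<integral>\<^sup>+y. ennreal (1 + \<bar>y\<bar> ^ k) \<partial>std_normal_distribution)"
    by (intro nn_integral_mono ennreal_leI)
  ultimately show ?thesis by (rule le_less_trans[rotated])
qed

theorem theorem4:
  fixes \<alpha> :: "real measure" and s \<sigma> p :: real
  assumes "env_distribution \<alpha>"
    and "non_degenerate \<alpha>"
    and "uniformly_elliptic \<alpha>"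
    and "2 < s"
    and "s_transient s \<alpha>"
    and "is_diffusion_constant \<alpha> \<sigma>"
    and "0 < p" and "p < s"
  shows "Lp_converges_to_law p (annealed_law \<alpha>) (scaled_walk \<alpha> \<sigma>) std_normal_distribution"
proof -
  obtain c where c: "0 < c" "measure \<alpha> {c..1 - c} = 1"
    using assms(3) by (auto simp: uniformly_elliptic_def)
  interpret elliptic_environment \<alpha> c
    using assms(1) c by unfold_locales
  define q where "q = (max 2 p + s) / 2"
  have q_bounds: "2 \<le> q" "p < q" "q < s" using assms(4,8) by (auto simp: q_def)
  \<comment> \<open>The exponent 1 < s of the same convexity argument; it is what bounds Green's
    function in mean.\<close>
  have "m < 1"
    using integral_rho_powr_less_one[OF assms(5), of 1] assms(4)
      integral_rho_clip_powr[of 1] integral_rho_clip rho_clip(1)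
    by (simp add: less_imp_le)
  moreover have "(\<integral>w. rho w powr q \<partial>\<alpha>) < 1"
    using q_bounds by (intro integral_rho_powr_less_one[OF assms(5)]) auto
  ultimately interpret subunit_moment_environment \<alpha> c q
    using q_bounds by unfold_locales auto
  interpret annealed: prob_space "annealed_law \<alpha>"
    using assms(1) by (rule prob_space_annealed_law)
  have \<sigma>: "0 < \<sigma>"
    and conv: "weak_conv_m (\<lambda>n. distr (annealed_law \<alpha>) borel (scaled_walk \<alpha> \<sigma> n)) std_normal_distribution"
    using assms(6) by (auto simp: is_diffusion_constant_def)
  note W [measurable] = measurable_scaled_walk[OF assms(1), of \<sigma>]
  obtain C where C: "0 \<le> C" "\<And>n. 1 \<le> n \<Longrightarrow>
    \<mu>.expectation (\<lambda>\<omega>. quenched_mean (\<lambda>x. clip (\<omega> x)) n (\<lambda>x. \<bar>of_int x - v * real n\<bar> powr q))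
      \<le> C * real n powr (q/2)"
    using annealed_moment by blast
  obtain C' where C': "0 \<le> C'"
    "(\<integral>\<^sup>+y. ennreal (\<bar>y\<bar> powr q) \<partial>std_normal_distribution) = ennreal C'"
    using std_normal_abs_moment_finite[of q] q_bounds by (auto simp: less_top_ennreal)
  have moment: "(\<integral>\<^sup>+z. ennreal (\<bar>scaled_walk \<alpha> \<sigma> n z\<bar> powr q) \<partial>annealed_law \<alpha>)
      \<le> ennreal (max (C / \<sigma> powr q) C')" if n: "1 \<le> n" for n
  proof -
    \<comment> \<open>The q-th power of the normalisation; its factor n^(q/2) cancels the growth in
      \<open>annealed_moment\<close>.\<close>
    define a where "a = \<sigma> powr q * real n powr (q/2)"
    have a: "0 < a" using \<sigma> n by (simp add: a_def)
    have "(\<sigma> * sqrt (real n)) powr q = \<sigma> powr q * (real n powr (1/2)) powr q"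
      using \<sigma> by (simp add: powr_mult powr_half_sqrt)
    then have denom: "(\<sigma> * sqrt (real n)) powr q = a" by (simp add: a_def powr_powr)
    have scaled: "\<bar>scaled_walk \<alpha> \<sigma> n z\<bar> powr q = (1/a) * \<bar>of_int (z n) - v * real n\<bar> powr q" for z
      using \<sigma> by (simp add: scaled_walk_def v_eq_speed abs_mult powr_divide flip: denom)
    have "(\<integral>\<^sup>+z. ennreal (\<bar>scaled_walk \<alpha> \<sigma> n z\<bar> powr q) \<partial>annealed_law \<alpha>) =
        (\<integral>\<^sup>+z. ennreal (1/a) * ennreal (\<bar>of_int (z n) - v * real n\<bar> powr q) \<partial>annealed_law \<alpha>)"
      unfolding scaled using a by (intro nn_integral_cong ennreal_mult) auto
    also have "\<dots> = ennreal (1/a) * (\<integral>\<^sup>+z. ennreal (\<bar>of_int (z n) - v * real n\<bar> powr q) \<partial>annealed_law \<alpha>)"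
    proof (rule nn_integral_cmult)
      have "(\<lambda>z. ennreal (\<bar>of_int (z n) - v * real n\<bar> powr q)) \<in> borel_measurable path_space"
        by measurable
      then show "(\<lambda>z. ennreal (\<bar>of_int (z n) - v * real n\<bar> powr q)) \<in> borel_measurable (annealed_law \<alpha>)"
        using measurable_cong_sets[OF sets_annealed_law[OF assms(1)] refl] by blast
    qed
    also have "\<dots> \<le> ennreal (1/a) * ennreal (C * real n powr (q/2))"
      unfolding nn_integral_annealed_law[of "\<lambda>x. \<bar>of_int x - v * real n\<bar> powr q" n, OF powr_ge_zero]
      by (intro mult_left_mono ennreal_leI C n) auto
    also have "\<dots> = ennreal (C / \<sigma> powr q)"
      using a n C by (simp add: a_def flip: ennreal_mult)
    finally show ?thesis by (rule order_trans) (simp add: ennreal_leI)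
  qed
  have real_distr: "real_distribution (distr (annealed_law \<alpha>) borel (scaled_walk \<alpha> \<sigma> n))" for n
    by (rule annealed.real_distribution_distr[OF W])
  have bound: "(\<integral>\<^sup>+y. ennreal (\<bar>y\<bar> powr q) \<partial>distr (annealed_law \<alpha>) borel (scaled_walk \<alpha> \<sigma> n))
      \<le> ennreal (max (C / \<sigma> powr q) C')" if "1 \<le> n" for n
    using moment[OF that] by (simp add: nn_integral_distr)
  have bound': "(\<integral>\<^sup>+y. ennreal (\<bar>y\<bar> powr q) \<partial>std_normal_distribution) \<le> ennreal (max (C / \<sigma> powr q) C')"
    unfolding C' by (simp add: ennreal_leI)
  have "0 \<le> max (C / \<sigma> powr q) C'" using C' by simp
  note lim = weak_conv_imp_moment_conv[OF real_distr real_dist_normal_dist conv assms(7) q_bounds(2) this bound bound']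
  show ?thesis
    unfolding Lp_converges_to_law_def
    using conv lim by (simp add: nn_integral_distr)
qed

end
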